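(* Let $(\mathcal{X},d_{\mathcal X})$ be a geodesic metric space and, for $\beta\in(0,\infty)$, let $\tilde{\mathcal X}_\beta$ be the metric cone of $\mathcal{X}$ with parameter $\beta$. Then: 1. If $\mathcal{X}$ is a CAT(0) space, then $\tilde{\mathcal X}_\beta$ is also CAT(0) for every $\beta\in(0,\infty)$. 2. If $\tilde{\mathcal X}_{\beta_2}$ is CAT(0), then $\tilde{\mathcal X}_{\beta_1}$ is also CAT(0) for every $0<\beta_1<\beta_2$. 3. If $\mathcal{X}$ is CAT($k$) for some $k\ge 0$, then $\tilde{\mathcal X}_\beta$ is CAT(0) for every $\beta\in(0,\infty)$ with $\beta\le \pi/\sqrt{k}$ (where $\pi/\sqrt{k}=\infty$ if $k=0$).
   Context: For a geodesic metric space $(\mathcal{X},d_{\mathcal X})$ and $\beta\in(0,\infty)$, the metric cone $\tilde{\mathcal X}_\beta$ is the cone $\mathcal{X}\times[0,1]/(\mathcal{X}\times\{0\})$ (all points $(x,0)$ identified to one apex) with the metric $$\tilde d_\beta((x,s),(y,t))=\tfrac12\sqrt{t^2+s^2-2ts\cos\bigl(\pi\min(d_{\mathcal X}(x,y)/\beta,1)\bigr)}.$$ CAT($k$) property, $k\in\mathbb{R}$: a geodesic metric space is CAT($k$) if for every geodesic triangle with vertices $a,b,c$ of perimeter less than $2\pi/\sqrt{\max(k,0)}$ ($=\infty$ if $k\le0$), every comparison triangle $a',b',c'$ with the same side lengths in the model surface $\mathcal{M}_k$ of constant curvature $k$ (Euclidean plane if $k=0$, sphere of radius $1/\sqrt{k}$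 if $k>0$), and every point $x$ on the geodesic side from $b$ to $c$ with corresponding point $x'$ on the side $b'c'$ (same distance from $b'$ as $x$ from $b$), one has $d(x,a)\le d_{\mathcal{M}_k}(x',a')$. *)

theory Defs
  imports "HOL-Analysis.Analysis"
begin

section \<open>Geodesic metric spaces\<close>

definition geodesic :: "'a set \<Rightarrow> ('a \<Rightarrow> 'a \<Rightarrow> real) \<Rightarrow> 'a \<Rightarrow> 'a \<Rightarrow> (real \<Rightarrow> 'a) \<Rightarrow> bool" where
  "geodesic M d x y \<gamma> \<longleftrightarrow>
     \<gamma> \<in> {0..d x y} \<rightarrow> M \<and> \<gamma> 0 = x \<and> \<gamma> (d x y) = y \<and>
     (\<forall>s\<in>{0..d x y}. \<forall>t\<in>{0..d x y}. d (\<gamma> s) (\<gamma> t) = \<bar>s - t\<bar>)"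

definition geodesic_space :: "'a set \<Rightarrow> ('a \<Rightarrow> 'a \<Rightarrow> real) \<Rightarrow> bool" where
  "geodesic_space M d \<longleftrightarrow>
     Metric_space M d \<and> (\<forall>x\<in>M. \<forall>y\<in>M. \<exists>\<gamma>. geodesic M d x y \<gamma>)"

text \<open>The sides \<open>p\<close>, \<open>q\<close>, \<open>r\<close> run from \<open>b\<close> to \<open>c\<close>, from \<open>c\<close> to \<open>a\<close> and from \<open>a\<close> to \<open>b\<close>.\<close>

definition geodesic_triangle ::
  "'a set \<Rightarrow> ('a \<Rightarrow> 'a \<Rightarrow> real) \<Rightarrow> 'a \<Rightarrow> 'a \<Rightarrow> 'a \<Rightarrow>
   (real \<Rightarrow> 'a) \<Rightarrow> (real \<Rightarrow> 'a) \<Rightarrow> (real \<Rightarrow> 'a) \<Rightarrow> bool" where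
  "geodesic_triangle M d a b c p q r \<longleftrightarrow>
     a \<in> M \<and> b \<in> M \<and> c \<in> M \<and>
     geodesic M d b c p \<and> geodesic M d c a q \<and> geodesic M d a b r"

section \<open>Model surfaces of constant curvature\<close>

text \<open>All model surfaces are realised in \<open>real^3\<close>: the plane \<open>z = 0\<close> for \<open>k = 0\<close>, the sphere of
  radius \<open>1 / sqrt k\<close> with its angular (intrinsic) distance for \<open>k > 0\<close>, and the upper sheet of the
  hyperboloid \<open>lorentz p p = 1 / k\<close> for \<open>k < 0\<close>.\<close>

definition lorentz :: "real^3 \<Rightarrow> real^3 \<Rightarrow> real" where
  "lorentz p q = p $ 1 * q $ 1 + p $ 2 * q $ 2 - p $ 3 * q $ 3"

definition model_surface :: "real \<Rightarrow> (real^3) set" where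
  "model_surface k =
     (if k = 0 then {p. p $ 3 = 0}
      else if k > 0 then sphere 0 (1 / sqrt k)
      else {p. lorentz p p = 1 / k \<and> p $ 3 > 0})"

definition model_dist :: "real \<Rightarrow> real^3 \<Rightarrow> real^3 \<Rightarrow> real" where
  "model_dist k p q =
     (if k = 0 then dist p q
      else if k > 0 then arccos (k * (p \<bullet> q)) / sqrt k
      else arcosh (k * lorentz p q) / sqrt (- k))"

section \<open>The CAT property\<close>

text \<open>For \<open>k \<le> 0\<close> the perimeter bound is infinite, that is, there is none.\<close>

definition CAT :: "real \<Rightarrow> 'a set \<Rightarrow> ('a \<Rightarrow> 'a \<Rightarrow> real) \<Rightarrow> bool" where
  "CAT k M d \<longleftrightarrow>
     geodesic_space M d \<and>
     (\<forall>a b c p q r a' b' c' p' q' r'.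
        geodesic_triangle M d a b c p q r \<and>
        (k > 0 \<longrightarrow> d a b + d b c + d c a < 2 * pi / sqrt k) \<and>
        geodesic_triangle (model_surface k) (model_dist k) a' b' c' p' q' r' \<and>
        model_dist k a' b' = d a b \<and> model_dist k b' c' = d b c \<and> model_dist k c' a' = d c a \<longrightarrow>
        (\<forall>t\<in>{0..d b c}. d (p t) a \<le> model_dist k (p' t) a'))"

section \<open>The metric cone\<close>

definition cone_rel :: "'a set \<Rightarrow> (('a \<times> real) \<times> ('a \<times> real)) set" where
  "cone_rel M =
     {(u, v). u \<in> M \<times> {0..1} \<and> v \<in> M \<times> {0..1} \<and> (u = v \<or> snd u = 0 \<and> snd v = 0)}"

definition metric_cone :: "'a set \<Rightarrow> ('a \<times> real) set set" where
  "metric_cone M = (M \<times> {0..1}) // cone_rel M"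

definition precone_dist ::
  "real \<Rightarrow> ('a \<Rightarrow> 'a \<Rightarrow> real) \<Rightarrow> 'a \<times> real \<Rightarrow> 'a \<times> real \<Rightarrow> real" where
  "precone_dist \<beta> d = (\<lambda>(x, s) (y, t).
     1/2 * sqrt (t\<^sup>2 + s\<^sup>2 - 2 * t * s * cos (pi * min (d x y / \<beta>) 1)))"

text \<open>Independence of the chosen representatives is the lemma \<open>cone_dist_class\<close> below.\<close>

definition cone_dist ::
  "real \<Rightarrow> ('a \<Rightarrow> 'a \<Rightarrow> real) \<Rightarrow> ('a \<times> real) set \<Rightarrow> ('a \<times> real) set \<Rightarrow> real" where
  "cone_dist \<beta> d C D = precone_dist \<beta> d (SOME u. u \<in> C) (SOME v. v \<in> D)"

lemma equiv_cone_rel: "equiv (M \<times> {0..1}) (cone_rel M)"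
  by (rule equivI) (auto simp: cone_rel_def refl_on_def sym_def trans_def)

lemma precone_dist_cong:
  assumes "(u, u') \<in> cone_rel M" "(v, v') \<in> cone_rel M"
  shows "precone_dist \<beta> d u v = precone_dist \<beta> d u' v'"
  using assms by (auto simp: cone_rel_def precone_dist_def split: prod.splits)

lemma cone_dist_class:
  assumes "u \<in> M \<times> {0..1}" "v \<in> M \<times> {0..1}"
  shows "cone_dist \<beta> d (cone_rel M `` {u}) (cone_rel M `` {v}) = precone_dist \<beta> d u v"
proof -
  have "(w, SOME w'. w' \<in> cone_rel M `` {w}) \<in> cone_rel M" if "w \<in> M \<times> {0..1}" for w
    using someI[of "\<lambda>w'. w' \<in> cone_rel M `` {w}" w] equiv_class_self[OF equiv_cone_rel that]
    by blast
  from precone_dist_cong[OF this[OF assms(1)] this[OF assms(2)]]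
  show ?thesis by (simp add: cone_dist_def)
qed

end

theory Submission
  imports Defs
begin

text \<open>Both the CAT condition for \<open>X\<close> and the one for its cone are turned into inequalities between
  distances for a point \<open>z\<close> between \<open>b\<close> and \<open>c\<close>. For curvature \<open>\<rho>\<^sup>2\<close> the inequality
  says that the comparison angles at \<open>z\<close> in the triangles \<open>a b z\<close> and \<open>a c z\<close> add up to at least
  \<open>pi\<close>; by the half-angle formula these angles increase with \<open>\<rho>\<close>, since \<open>sin (\<rho> A) / sin (\<rho> P)\<close>
  does for \<open>A \<le> P\<close>, \<open>\<rho> P < pi\<close>. In the cone, Stewart's theorem turns the Euclidean inequality
  into concavity of the formal inner product \<open>s t cos (pi min (d x y / \<beta>) 1)\<close> along geodesics,
  and after cancelling the radial coordinates this is the inequality for \<open>X\<close> with \<open>\<rho> = pi / \<beta>\<close>.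
  So the cone is CAT(0) iff \<open>X\<close> satisfies the angle inequality for \<open>\<rho> = pi / \<beta>\<close>, and all
  three claims follow from monotonicity in \<open>\<rho>\<close>.\<close>

section \<open>Monotonicity of comparison angles in the curvature\<close>

text \<open>In the trigonometric inequality every term moves with \<rho>, so monotonicity is
  invisible there. The angle form splits it into two triangles, each contributing one angle. The
  angles themselves never occur: for \<phi>, \<psi> in [0, pi], \<phi> + \<psi> \<ge> pi is
  equivalent to sin^2(\<phi>/2) + sin^2(\<psi>/2) \<ge> 1, and this form makes sense for \<rho> = 0
  as well. To include that case, \<open>sn \<rho>\<close> is normalised as the solution of f'' =
  -\<rho>^2 f with f(0) = 0, f'(0) = 1. Two obstacles lie in the cone. A point between B and C is
  known only through its distances, so its position over the base has to be derived from them before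
  the inequality for \<open>X\<close> can be applied. And the cone truncates angles at pi, while the
  inequality for \<open>X\<close> is available only for perimeters below 2 pi; larger triangles
  require a separate elementary argument. For the way back from the cone, a triangle of
  \<open>X\<close> is lifted to radius 1 and the point between two vertices to the radius at which
  the chord crosses its ray.\<close>

definition sn :: "real \<Rightarrow> real \<Rightarrow> real" where
  "sn \<rho> t = (if \<rho> = 0 then t else sin (\<rho> * t) / \<rho>)"

lemma sn_zero [simp]: "sn \<rho> 0 = 0"
  by (simp add: sn_def)

lemma DERIV_sn: "(sn \<rho> has_real_derivative cos (\<rho> * t)) (at t)"
proof (cases "\<rho> = 0")
  case True
  have "sn \<rho> = (\<lambda>t. t)" using True by (auto simp: sn_def)
  then show ?thesis using True by simp
next
  case False
  have "sn \<rho> = (\<lambda>t. sin (\<rho> * t) / \<rho>)" using False by (auto simp: sn_def)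
  then show ?thesis using False by (auto intro!: derivative_eq_intros)
qed

lemma DERIV_cos_sn: "((\<lambda>t. cos (\<rho> * t)) has_real_derivative - \<rho>\<^sup>2 * sn \<rho> t) (at t)"
  by (cases "\<rho> = 0") (auto intro!: derivative_eq_intros simp: sn_def power2_eq_square)

lemma sn_pos:
  assumes "0 \<le> \<rho>" "0 < t" "\<rho> * t < pi"
  shows "0 < sn \<rho> t"
  using assms by (auto simp: sn_def intro!: divide_pos_pos sin_gt_zero)

lemma sn_nonneg:
  assumes "0 \<le> \<rho>" "0 \<le> t" "\<rho> * t < pi"
  shows "0 \<le> sn \<rho> t"
  using assms sn_pos[of \<rho> t] by (cases "t = 0") (auto simp: sn_def)

text \<open>A Sturm comparison: \<open>sn \<rho> / sn \<sigma>\<close> is nonincreasing. The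
  numerator \<open>N\<close> of its derivative vanishes at 0 and has derivative (\<sigma>^2 -
  \<rho>^2) \<open>sn \<sigma>\<close> \<open>sn \<rho>\<close>, which is nonpositive as long as
  both factors are nonnegative.\<close>

lemma sn_ratio_mono:
  assumes "0 \<le> \<sigma>" "\<sigma> \<le> \<rho>" "0 \<le> a" "a \<le> p" "\<rho> * p < pi"
  shows "sn \<sigma> a * sn \<rho> p \<le> sn \<rho> a * sn \<sigma> p"
proof (cases "a = 0")
  case True
  then show ?thesis by (simp add: sn_def)
next
  case False
  with assms have a: "0 < a" by simp
  have rng: "\<rho> * t < pi" "\<sigma> * t < pi" if "0 \<le> t" "t \<le> p" for t
  proof -
    have "\<rho> * t \<le> \<rho> * p" "\<sigma> * t \<le> \<rho> * t"
      using assms that by (auto intro: mult_left_mono mult_right_mono)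
    with assms show "\<rho> * t < pi" "\<sigma> * t < pi" by linarith+
  qed
  define N where "N t = cos (\<rho> * t) * sn \<sigma> t - cos (\<sigma> * t) * sn \<rho> t" for t
  have dN: "(N has_real_derivative (\<sigma>\<^sup>2 - \<rho>\<^sup>2) * (sn \<sigma> t * sn \<rho> t)) (at t)" for t
    unfolding N_def
    by (rule derivative_eq_intros DERIV_sn DERIV_cos_sn refl)+ (simp add: algebra_simps)
  have sq: "\<sigma>\<^sup>2 \<le> \<rho>\<^sup>2" using assms by (intro power_mono) auto
  have N: "N t \<le> 0" if "0 \<le> t" "t \<le> p" for t
  proof -
    have "N t \<le> N 0"
    proof (rule DERIV_nonpos_imp_nonincreasing[OF that(1)])
      fix x assume "0 \<le> x" "x \<le> t"
      then have "0 \<le> sn \<sigma> x * sn \<rho> x"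
        using assms that rng[of x] by (intro mult_nonneg_nonneg sn_nonneg) auto
      then have "(\<sigma>\<^sup>2 - \<rho>\<^sup>2) * (sn \<sigma> x * sn \<rho> x) \<le> 0"
        using sq by (intro mult_nonpos_nonneg) auto
      then show "\<exists>y. (N has_real_derivative y) (at x) \<and> y \<le> 0"
        using dN by blast
    qed
    then show ?thesis by (simp add: N_def)
  qed
  define Q where "Q t = sn \<rho> t / sn \<sigma> t" for t
  have "Q p \<le> Q a"
  proof (rule DERIV_nonpos_imp_nonincreasing[OF assms(4)])
    fix x assume x: "a \<le> x" "x \<le> p"
    then have pos: "0 < sn \<sigma> x" using assms a rng[of x] by (intro sn_pos) auto
    have "(Q has_real_derivative N x / (sn \<sigma> x * sn \<sigma> x)) (at x)"
      unfolding Q_def N_def using pos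
      by (auto intro!: derivative_eq_intros DERIV_sn simp: algebra_simps)
    moreover have "N x / (sn \<sigma> x * sn \<sigma> x) \<le> 0"
      using N[of x] x a pos by (intro divide_nonpos_pos mult_pos_pos) auto
    ultimately show "\<exists>y. (Q has_real_derivative y) (at x) \<and> y \<le> 0" by blast
  qed
  moreover have "0 < sn \<sigma> a" "0 < sn \<sigma> p"
    using assms a rng[of a] rng[of p] by (auto intro!: sn_pos)
  ultimately show ?thesis by (simp add: Q_def field_simps)
qed

text \<open>By the half-angle formula this is \<open>(1 - cos \<phi>) / 2\<close> for the angle \<open>\<phi>\<close> opposite to \<open>x\<close>
  in the triangle with sides \<open>x\<close>, \<open>u\<close>, \<open>p\<close> in the model surface of curvature \<open>\<rho>\<^sup>2\<close>.\<close>

definition sin2_half_angle :: "real \<Rightarrow> real \<Rightarrow> real \<Rightarrow> real \<Rightarrow> real" where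
  "sin2_half_angle \<rho> x u p =
     sn \<rho> ((x + p - u) / 2) * sn \<rho> ((x + u - p) / 2) / (sn \<rho> u * sn \<rho> p)"

text \<open>The four factors are paired so that \<open>sn_ratio_mono\<close> applies to each
  quotient: (x + p - u)/2 \<le> p and (x + u - p)/2 \<le> u both say x \<le> u + p. All arguments
  are at most half the perimeter, hence below pi after scaling.\<close>

lemma sin2_half_angle_mono:
  assumes "0 \<le> \<sigma>" "\<sigma> \<le> \<rho>" "0 < u" "0 < p"
    and tri: "x \<le> u + p" "u \<le> x + p" "p \<le> x + u"
    and per: "\<rho> * (x + u + p) < 2 * pi"
  shows "sin2_half_angle \<sigma> x u p \<le> sin2_half_angle \<rho> x u p"
proof -
  have bd: "\<rho> * t < pi" if "t \<le> (x + u + p) / 2" for t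
  proof -
    have "\<rho> * t \<le> \<rho> * ((x + u + p) / 2)" using assms that by (intro mult_left_mono) auto
    with per show ?thesis by (simp add: algebra_simps)
  qed
  have bd': "\<sigma> * t < pi" if "0 \<le> t" "t \<le> (x + u + p) / 2" for t
    using bd[OF that(2)] mult_right_mono[OF assms(2) that(1)] by linarith
  let ?A = "(x + p - u) / 2" and ?B = "(x + u - p) / 2"
  have le: "sn \<sigma> ?A * sn \<rho> p \<le> sn \<rho> ?A * sn \<sigma> p" "sn \<sigma> ?B * sn \<rho> u \<le> sn \<rho> ?B * sn \<sigma> u"
    using assms by (auto intro!: sn_ratio_mono bd)
  have pos: "0 < sn \<sigma> p" "0 < sn \<rho> p" "0 < sn \<sigma> u" "0 < sn \<rho> u"
    using assms by (auto intro!: sn_pos bd bd')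
  have nn: "0 \<le> sn \<sigma> ?A" "0 \<le> sn \<sigma> ?B" "0 \<le> sn \<rho> ?A" "0 \<le> sn \<rho> ?B"
    using assms by (auto intro!: sn_nonneg bd bd')
  have "(sn \<sigma> ?A / sn \<sigma> p) * (sn \<sigma> ?B / sn \<sigma> u) \<le> (sn \<rho> ?A / sn \<rho> p) * (sn \<rho> ?B / sn \<rho> u)"
    using le pos nn by (intro mult_mono) (auto simp: field_simps)
  then show ?thesis by (simp add: sin2_half_angle_def mult.commute)
qed

text \<open>The spherical law of cosines, with 1 - 2 sin^2(\<phi>/2) in place of cos \<phi>. It is a
  product-to-sum identity and asks for no triangle inequality.\<close>

lemma cos_eq_sin2_half_angle:
  assumes "0 < \<rho>" "0 < sn \<rho> u" "0 < sn \<rho> p"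
  shows "cos (\<rho> * x) - cos (\<rho> * u) * cos (\<rho> * p) =
    sin (\<rho> * u) * sin (\<rho> * p) * (1 - 2 * sin2_half_angle \<rho> x u p)"
proof -
  have nz: "sin (\<rho> * u) \<noteq> 0" "sin (\<rho> * p) \<noteq> 0" using assms by (auto simp: sn_def)
  have e: "sin2_half_angle \<rho> x u p =
      sin (\<rho> * ((x + p - u) / 2)) * sin (\<rho> * ((x + u - p) / 2)) / (sin (\<rho> * u) * sin (\<rho> * p))"
    using assms(1) by (simp add: sin2_half_angle_def sn_def)
  have "2 * (sin (\<rho> * ((x + p - u) / 2)) * sin (\<rho> * ((x + u - p) / 2))) =
      cos (\<rho> * p - \<rho> * u) - cos (\<rho> * x)"
  proof -
    have "\<rho> * ((x + p - u) / 2) - \<rho> * ((x + u - p) / 2) = \<rho> * p - \<rho> * u"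
      "\<rho> * ((x + p - u) / 2) + \<rho> * ((x + u - p) / 2) = \<rho> * x"
      by (simp_all add: field_simps)
    then show ?thesis by (simp only: sin_times_sin) simp
  qed
  moreover have "sin (\<rho> * u) * sin (\<rho> * p) * (1 - 2 * sin2_half_angle \<rho> x u p) =
      sin (\<rho> * u) * sin (\<rho> * p) -
      2 * (sin (\<rho> * ((x + p - u) / 2)) * sin (\<rho> * ((x + u - p) / 2)))"
    unfolding e using nz by (simp add: right_diff_distrib)
  ultimately show ?thesis by (simp add: cos_diff)
qed

section \<open>Comparison inequalities for a point between two others\<close>

text \<open>The right-hand side is, by Stewart's theorem, \<open>d b c\<close> times the squared
  distance from the vertex \<open>a'\<close> of a Euclidean comparison triangle to the point
  corresponding to \<open>z\<close>.\<close>

definition flat_ineq :: "'a set \<Rightarrow> ('a \<Rightarrow> 'a \<Rightarrow> real) \<Rightarrow> bool" where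
  "flat_ineq M d \<longleftrightarrow> (\<forall>a\<in>M. \<forall>b\<in>M. \<forall>c\<in>M. \<forall>z\<in>M. d b z + d z c = d b c \<longrightarrow>
     d b c * (d z a)\<^sup>2 \<le> d z c * (d a b)\<^sup>2 + d b z * (d c a)\<^sup>2 - d b z * d z c * d b c)"

text \<open>The spherical counterpart of Stewart's theorem: on a great circle sin L z' = sin(L - t)
  b' + sin t c', and the inner product with a' gives the left-hand side. A smaller distance is a
  larger cosine.\<close>

definition trig_ineq :: "real \<Rightarrow> 'a set \<Rightarrow> ('a \<Rightarrow> 'a \<Rightarrow> real) \<Rightarrow> bool" where
  "trig_ineq \<rho> M d \<longleftrightarrow> (\<forall>a\<in>M. \<forall>b\<in>M. \<forall>c\<in>M. \<forall>z\<in>M. d b z + d z c = d b c \<longrightarrow>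
     \<rho> * (d a b + d b c + d c a) < 2 * pi \<longrightarrow>
     sin (\<rho> * d z c) * cos (\<rho> * d a b) + sin (\<rho> * d b z) * cos (\<rho> * d c a)
       \<le> sin (\<rho> * d b c) * cos (\<rho> * d z a))"

text \<open>The comparison angles at \<open>z\<close> add up to at least \<open>pi\<close>.\<close>

definition angle_ineq :: "real \<Rightarrow> 'a set \<Rightarrow> ('a \<Rightarrow> 'a \<Rightarrow> real) \<Rightarrow> bool" where
  "angle_ineq \<rho> M d \<longleftrightarrow> (\<forall>a\<in>M. \<forall>b\<in>M. \<forall>c\<in>M. \<forall>z\<in>M. d b z + d z c = d b c \<longrightarrow>
     \<rho> * (d a b + d b c + d c a) < 2 * pi \<longrightarrow> 0 < d z a \<longrightarrow> 0 < d b z \<longrightarrow> 0 < d z c \<longrightarrow>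
     1 \<le> sin2_half_angle \<rho> (d a b) (d z a) (d b z) + sin2_half_angle \<rho> (d c a) (d z a) (d z c))"

text \<open>Raising the parameter restricts the admissible triangles and enlarges both summands. The
  summands belong to the triangles a b z and a c z, whose perimeters do not exceed that of a b c
  because z lies between b and c.\<close>

lemma angle_ineq_mono:
  assumes "Metric_space M d" "0 \<le> \<sigma>" "\<sigma> \<le> \<rho>" "angle_ineq \<sigma> M d"
  shows "angle_ineq \<rho> M d"
  unfolding angle_ineq_def
proof (intro ballI impI)
  interpret Metric_space M d by fact
  fix a b c z
  assume M: "a \<in> M" "b \<in> M" "c \<in> M" "z \<in> M" and btw: "d b z + d z c = d b c"
    and per: "\<rho> * (d a b + d b c + d c a) < 2 * pi" and pos: "0 < d z a" "0 < d b z" "0 < d z c"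
  note tri = triangle[OF M(1,4,2)] triangle[OF M(4,1,2)] triangle[OF M(1,2,4)] triangle[OF M(4,3,1)]
    triangle[OF M(3,4,1)] triangle[OF M(3,1,4)]
    commute[of a z] commute[of b z] commute[of c z] commute[of c a] commute[of a b]
  have "d a b + d z a + d b z \<le> d a b + d b c + d c a" "d c a + d z a + d z c \<le> d a b + d b c + d c a"
    using tri btw by linarith+
  then have le: "\<rho> * (d a b + d z a + d b z) < 2 * pi" "\<rho> * (d c a + d z a + d z c) < 2 * pi"
    using per assms(2,3) by (meson mult_left_mono order_trans le_less_trans)+
  have "\<sigma> * (d a b + d b c + d c a) < 2 * pi"
    using per mult_right_mono[OF assms(3), of "d a b + d b c + d c a"] nonneg[of a b] nonneg[of b c] nonneg[of c a]
    by linarith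
  then have "1 \<le> sin2_half_angle \<sigma> (d a b) (d z a) (d b z) + sin2_half_angle \<sigma> (d c a) (d z a) (d z c)"
    using assms(4) M btw pos by (auto simp: angle_ineq_def)
  also have "\<dots> \<le> sin2_half_angle \<rho> (d a b) (d z a) (d b z) + sin2_half_angle \<rho> (d c a) (d z a) (d z c)"
    by (intro add_mono sin2_half_angle_mono) (use assms(2,3) pos le tri in linarith)+
  finally show "1 \<le> sin2_half_angle \<rho> (d a b) (d z a) (d b z) + sin2_half_angle \<rho> (d c a) (d z a) (d z c)" .
qed

lemma flat_ineq_imp_angle_ineq:
  assumes "flat_ineq M d"
  shows "angle_ineq 0 M d"
  unfolding angle_ineq_def
proof (intro ballI impI)
  fix a b c z
  assume M: "a \<in> M" "b \<in> M" "c \<in> M" "z \<in> M" and btw: "d b z + d z c = d b c"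
    and pos: "0 < d z a" "0 < d b z" "0 < d z c"
  have "d b c * (d z a)\<^sup>2 \<le> d z c * (d a b)\<^sup>2 + d b z * (d c a)\<^sup>2 - d b z * d z c * d b c"
    using assms M btw by (auto simp: flat_ineq_def)
  \<comment> \<open>For \<rho> = 0 a summand equals (x^2 - (p - u)^2)/(4 u p). This is the sum minus
    1 over a common denominator; the numerator expands to the difference of the two sides of the
    flat inequality.\<close>
  then have "0 \<le> (d z c * ((d a b)\<^sup>2 - (d b z - d z a)\<^sup>2) + d b z * ((d c a)\<^sup>2 - (d z c - d z a)\<^sup>2)
      - 4 * d z a * d b z * d z c) / (4 * d z a * d b z * d z c)"
    using pos unfolding btw[symmetric]
    by (intro divide_nonneg_pos) (auto simp: algebra_simps power2_eq_square)
  also have "\<dots> = sin2_half_angle 0 (d a b) (d z a) (d b z) + sin2_half_angle 0 (d c a) (d z a) (d z c) - 1"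
    using pos by (simp add: sin2_half_angle_def sn_def field_simps power2_eq_square)
  finally show "1 \<le> sin2_half_angle 0 (d a b) (d z a) (d b z) + sin2_half_angle 0 (d c a) (d z a) (d z c)"
    by simp
qed

text \<open>No side of a triangle exceeds half the perimeter, so the perimeter bound keeps every
  scaled side below pi.\<close>

lemma mult_less_pi_of_half:
  fixes \<rho> t :: real
  assumes "\<rho> * P < 2 * pi" "0 < \<rho>" "2 * t \<le> P"
  shows "\<rho> * t < pi"
  using mult_left_mono[OF assms(3), of \<rho>] assms by linarith

lemma angle_ineq_iff_trig_ineq:
  assumes "Metric_space M d" "0 < \<rho>"
  shows "angle_ineq \<rho> M d \<longleftrightarrow> trig_ineq \<rho> M d"
proof -
  interpret Metric_space M d by fact
  have key: "(0 < d z a \<longrightarrow> 0 < d b z \<longrightarrow> 0 < d z c \<longrightarrow>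
      1 \<le> sin2_half_angle \<rho> (d a b) (d z a) (d b z) + sin2_half_angle \<rho> (d c a) (d z a) (d z c)) \<longleftrightarrow>
     sin (\<rho> * d z c) * cos (\<rho> * d a b) + sin (\<rho> * d b z) * cos (\<rho> * d c a)
       \<le> sin (\<rho> * d b c) * cos (\<rho> * d z a)"
    if M: "a \<in> M" "b \<in> M" "c \<in> M" "z \<in> M" and btw: "d b z + d z c = d b c"
      and per: "\<rho> * (d a b + d b c + d c a) < 2 * pi" for a b c z
  proof (cases "0 < d z a \<and> 0 < d b z \<and> 0 < d z c")
    case False
    then consider "z = a" | "b = z" | "z = c"
      using M by (metis zero nonneg less_eq_real_def)
    \<comment> \<open>When z coincides with a, b or c the trigonometric inequality is an equality,
      which matches the vacuous truth of the angle inequality.\<close>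
    then have "sin (\<rho> * d z c) * cos (\<rho> * d a b) + sin (\<rho> * d b z) * cos (\<rho> * d c a)
       = sin (\<rho> * d b c) * cos (\<rho> * d z a)"
    proof cases
      case 1
      then show ?thesis using M btw commute[of a b] commute[of c a]
        by (simp add: distrib_left sin_add flip: btw)
    qed (use M commute in auto)
    with False show ?thesis by auto
  next
    case True
    note mult_less_pi_of_half[OF per assms(2)]
    moreover have "2 * d z a \<le> d a b + d b c + d c a"
        "2 * d b z \<le> d a b + d b c + d c a" "2 * d z c \<le> d a b + d b c + d c a"
      using btw triangle[OF M(4,2,1)] triangle[OF M(4,3,1)] triangle[OF M(2,1,3)] nonneg[of b z] nonneg[of z c]
        commute[of a b] commute[of c a] commute[of z b] by - linarith+
    ultimately have sn: "0 < sn \<rho> (d z a)" "0 < sn \<rho> (d b z)" "0 < sn \<rho> (d z c)"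
      using True assms(2) by (auto intro!: sn_pos)
    then have sin: "0 < sin (\<rho> * d z a)" "0 < sin (\<rho> * d b z)" "0 < sin (\<rho> * d z c)"
      using assms(2) by (auto simp: sn_def zero_less_divide_iff)
    let ?K = "sin (\<rho> * d z a) * sin (\<rho> * d b z) * sin (\<rho> * d z c)"
    let ?A = "sin2_half_angle \<rho> (d a b) (d z a) (d b z)"
    let ?B = "sin2_half_angle \<rho> (d c a) (d z a) (d z c)"
    have "sin (\<rho> * d z c) * cos (\<rho> * d a b) + sin (\<rho> * d b z) * cos (\<rho> * d c a)
       - sin (\<rho> * d b c) * cos (\<rho> * d z a)
       = sin (\<rho> * d z c) * (cos (\<rho> * d a b) - cos (\<rho> * d z a) * cos (\<rho> * d b z))
       + sin (\<rho> * d b z) * (cos (\<rho> * d c a) - cos (\<rho> * d z a) * cos (\<rho> * d z c))"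
      by (simp add: distrib_left sin_add algebra_simps flip: btw)
    also have "\<dots> = 2 * ?K * (1 - (?A + ?B))"
      unfolding cos_eq_sin2_half_angle[OF assms(2) sn(1,2)] cos_eq_sin2_half_angle[OF assms(2) sn(1,3)]
      by (simp add: algebra_simps)
    finally have "sin (\<rho> * d z c) * cos (\<rho> * d a b) + sin (\<rho> * d b z) * cos (\<rho> * d c a)
       \<le> sin (\<rho> * d b c) * cos (\<rho> * d z a) \<longleftrightarrow> 2 * ?K * (1 - (?A + ?B)) \<le> 0"
      by linarith
    also have "\<dots> \<longleftrightarrow> 1 \<le> ?A + ?B"
      using sin by (simp add: mult_le_0_iff zero_less_mult_iff)
    finally show ?thesis using True by auto
  qed
  show ?thesis
    unfolding angle_ineq_def trig_ineq_def
    by (intro ball_cong imp_cong refl) (rule key; assumption)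
qed

section \<open>Geodesics\<close>

text \<open>Applied with \<open>f\<close> the identity for the plane, with an unrolled sector for
  the cone, and with a real interval for paths through the apex.\<close>

lemma geodesic_of_segment:
  fixes v w :: "'b::real_normed_vector"
  assumes f: "\<And>y. y \<in> closed_segment v w \<Longrightarrow> f y \<in> M"
    and iso: "\<And>y z. y \<in> closed_segment v w \<Longrightarrow> z \<in> closed_segment v w \<Longrightarrow> d (f y) (f z) = dist y z"
  shows "geodesic M d (f v) (f w) (\<lambda>t. f (v + (t / dist v w) *\<^sub>R (w - v)))"
proof (cases "v = w")
  case True
  then show ?thesis using f[of v] iso[of v v] by (auto simp: geodesic_def)
next
  case False
  have seg: "v + (t / dist v w) *\<^sub>R (w - v) \<in> closed_segment v w" if "t \<in> {0..dist v w}" for t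
    using that False unfolding in_segment
    by (intro exI[of _ "t / dist v w"]) (auto simp: algebra_simps)
  have "dist (v + (s / dist v w) *\<^sub>R (w - v)) (v + (t / dist v w) *\<^sub>R (w - v)) = \<bar>s - t\<bar>" for s t
  proof -
    have "v + (s / dist v w) *\<^sub>R (w - v) - (v + (t / dist v w) *\<^sub>R (w - v))
        = ((s - t) / dist v w) *\<^sub>R (w - v)"
      by (simp add: scaleR_diff_left diff_divide_distrib)
    then show ?thesis using False by (simp add: dist_norm norm_minus_commute)
  qed
  moreover have "d (f v) (f w) = dist v w" by (simp add: iso)
  ultimately show ?thesis using False by (auto simp: geodesic_def seg f iso)
qed

lemma geodesic_dist:
  assumes "geodesic M d b c p" "t \<in> {0..d b c}"
  shows "p t \<in> M" "d b (p t) = t" "d (p t) c = d b c - t"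
proof -
  have iso: "d (p s) (p t) = \<bar>s - t\<bar>" if "s \<in> {0..d b c}" "t \<in> {0..d b c}" for s t
    using assms(1) that by (auto simp: geodesic_def)
  show "p t \<in> M" using assms by (auto simp: geodesic_def)
  show "d b (p t) = t" "d (p t) c = d b c - t"
    using iso[of 0 t] iso[of t "d b c"] assms by (auto simp: geodesic_def)
qed

text \<open>\<open>CAT\<close> quantifies over geodesics, the inequalities over points between two
  others. Every such point lies on a geodesic, obtained by joining one from b to z and one from z to
  c.\<close>

lemma geodesic_through:
  assumes "geodesic_space M d" "b \<in> M" "c \<in> M" "z \<in> M" and btw: "d b z + d z c = d b c"
  obtains p where "geodesic M d b c p" "p (d b z) = z"
proof -
  interpret Metric_space M d using assms by (simp add: geodesic_space_def)
  obtain g h where g: "geodesic M d b z g" and h: "geodesic M d z c h"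
    using assms by (meson geodesic_space_def)
  define p where "p t = (if t \<le> d b z then g t else h (t - d b z))" for t
  \<comment> \<open>The upper bound goes through z; the lower bound holds because a shortcut would
    make the path from b to c shorter than \<open>d b c\<close>.\<close>
  have mixed: "d (g s) (h (t - d b z)) = t - s"
    if "0 \<le> s" "s \<le> d b z" "d b z < t" "t \<le> d b c" for s t
  proof -
    have t: "t - d b z \<in> {0..d z c}" and s: "s \<in> {0..d b z}" using that btw by auto
    note G = geodesic_dist[OF g s] and H = geodesic_dist[OF h t]
    show ?thesis
      using triangle[OF G(1) \<open>z \<in> M\<close> H(1)] triangle[OF \<open>b \<in> M\<close> G(1) \<open>c \<in> M\<close>]
        triangle[OF G(1) H(1) \<open>c \<in> M\<close>] G H btw by linarith
  qed
  have "p t \<in> M" if "t \<in> {0..d b c}" for t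
    using g h btw that by (auto simp: geodesic_def p_def)
  moreover have "p 0 = b" "p (d b z) = z" using g by (auto simp: geodesic_def p_def)
  moreover have "p (d b c) = c"
  proof (cases "d z c = 0")
    case True
    then have "z = c" using assms by simp
    then show ?thesis using g by (simp add: geodesic_def p_def)
  next
    case False
    then have "\<not> d b c \<le> d b z" using btw nonneg[of z c] by linarith
    then show ?thesis using h by (simp add: geodesic_def p_def flip: btw)
  qed
  moreover have "d (p s) (p t) = \<bar>s - t\<bar>" if "s \<in> {0..d b c}" "t \<in> {0..d b c}" for s t
  proof -
    consider "s \<le> d b z" "t \<le> d b z" | "s \<le> d b z" "d b z < t" | "d b z < s" "t \<le> d b z"
      | "d b z < s" "d b z < t" by linarith
    then show ?thesis
    proof cases
      case 1 then show ?thesis using g that by (auto simp: geodesic_def p_def)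
    next
      case 2 then show ?thesis using mixed[of s t] that by (auto simp: p_def)
    next
      case 3 then show ?thesis using mixed[of t s] that by (auto simp: p_def commute)
    next
      case 4
      then have "s - d b z \<in> {0..d z c}" "t - d b z \<in> {0..d z c}" using that btw by auto
      then have "d (h (s - d b z)) (h (t - d b z)) = \<bar>(s - d b z) - (t - d b z)\<bar>"
        using h unfolding geodesic_def by blast
      with 4 show ?thesis by (simp add: p_def)
    qed
  qed
  ultimately show ?thesis using that[of p] by (auto simp: geodesic_def)
qed

section \<open>The flat model\<close>

text \<open>Equality in the triangle inequality makes b - z and z - c parallel, so after weighting
  with the opposite lengths their inner products with z - a cancel.\<close>

lemma stewart:
  fixes a b c z :: "'b::real_inner"
  assumes "dist b z + dist z c = dist b c"
  shows "dist b c * (dist z a)\<^sup>2 =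
    dist z c * (dist a b)\<^sup>2 + dist b z * (dist c a)\<^sup>2 - dist b z * dist z c * dist b c"
proof -
  define u v w where "u = b - z" and "v = z - c" and "w = z - a"
  have e: "norm u *\<^sub>R v = norm v *\<^sub>R u"
    using assms[symmetric] unfolding dist_triangle_eq u_def v_def .
  have nd: "dist b z = norm u" "dist z c = norm v" "dist z a = norm w" "dist b c = norm u + norm v"
    "dist a b = norm (u + w)" "dist c a = norm (w - v)"
    using assms by (simp_all add: u_def v_def w_def dist_norm norm_minus_commute)
  have "norm v * (u \<bullet> w) = norm u * (v \<bullet> w)"
    using arg_cong[OF e, of "\<lambda>x. x \<bullet> w"] by simp
  then have "2 * norm v * (u \<bullet> w) = 2 * norm u * (v \<bullet> w)" by simp
  moreover have e2: "(norm (u + w))\<^sup>2 = (norm u)\<^sup>2 + (norm w)\<^sup>2 + 2 * (u \<bullet> w)"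
    "(norm (w - v))\<^sup>2 = (norm v)\<^sup>2 + (norm w)\<^sup>2 - 2 * (v \<bullet> w)"
    unfolding power2_norm_eq_inner by (simp_all add: inner_simps inner_commute)
  ultimately show ?thesis
    unfolding nd e2 by (simp add: power2_eq_square algebra_simps)
qed

lemma model_dist_0: "model_dist 0 = dist"
  by (auto simp: model_dist_def fun_eq_iff)

lemma closed_segment_plane:
  assumes "b \<in> model_surface 0" "c \<in> model_surface 0"
  shows "closed_segment b c \<subseteq> model_surface 0"
  using assms by (auto simp: model_surface_def in_segment)

lemma geodesic_plane:
  assumes "b \<in> model_surface 0" "c \<in> model_surface 0"
  shows "\<exists>p. geodesic (model_surface 0) (model_dist 0) b c p"
  using geodesic_of_segment[of b c "\<lambda>x. x" "model_surface 0" dist] closed_segment_plane[OF assms]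
  by (auto simp: model_dist_0)

lemma comparison_triangle_plane:
  fixes x y l :: real
  assumes "0 < l" "0 \<le> x" "0 \<le> y" "x \<le> y + l" "y \<le> x + l" "l \<le> x + y"
  obtains a b c where "a \<in> model_surface 0" "b \<in> model_surface 0" "c \<in> model_surface 0"
    "dist a b = x" "dist b c = l" "dist c a = y"
proof -
  \<comment> \<open>With b at the origin and c on the first axis, the law of cosines forces this
    first coordinate of a. The triangle inequalities are what gives h^2 \<le> x^2, so that the
    second coordinate exists.\<close>
  define h where "h = (x\<^sup>2 + l\<^sup>2 - y\<^sup>2) / (2 * l)"
  have hl: "2 * l * h = x\<^sup>2 + l\<^sup>2 - y\<^sup>2" using assms by (simp add: h_def)
  have "(2 * l * h)\<^sup>2 \<le> (2 * l * x)\<^sup>2"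
  proof (rule power2_le_iff_abs_le[THEN iffD2])
    have "(x - l)\<^sup>2 \<le> y\<^sup>2" using assms by (intro abs_le_square_iff[THEN iffD1]) auto
    moreover have "y\<^sup>2 \<le> (x + l)\<^sup>2" using assms by (intro power_mono) auto
    ultimately show "\<bar>2 * l * h\<bar> \<le> 2 * l * x"
      unfolding hl by (auto simp: abs_le_iff power2_eq_square algebra_simps)
  qed (use assms in auto)
  then have hx: "h\<^sup>2 \<le> x\<^sup>2" using assms by (simp add: power_mult_distrib)
  define a b c :: "real^3" where "a = vector [h, sqrt (x\<^sup>2 - h\<^sup>2), 0]" and "b = 0" and "c = vector [l, 0, 0]"
  have n: "norm v = sqrt ((v$1)\<^sup>2 + (v$2)\<^sup>2 + (v$3)\<^sup>2)" for v :: "real^3"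
    by (simp add: norm_vec_def L2_set_def sum_3)
  have "dist a b = x" using assms hx by (simp add: dist_norm n a_def b_def vector_3)
  moreover have "dist b c = l" using assms by (simp add: dist_norm n c_def b_def vector_3)
  moreover have "(l - h)\<^sup>2 + (x\<^sup>2 - h\<^sup>2) = y\<^sup>2"
    using hl by (simp add: power2_eq_square algebra_simps)
  then have "dist c a = y" using assms hx by (simp add: dist_norm n a_def c_def vector_3)
  moreover have "a \<in> model_surface 0" "b \<in> model_surface 0" "c \<in> model_surface 0"
    by (auto simp: model_surface_def a_def b_def c_def vector_3)
  ultimately show ?thesis using that by blast
qed

lemma flat_ineq_imp_CAT_0:
  assumes "geodesic_space M d" "flat_ineq M d"
  shows "CAT 0 M d"
  unfolding CAT_def
proof (intro conjI allI impI ballI; (elim conjE)?)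
  interpret Metric_space M d using assms by (simp add: geodesic_space_def)
  fix a b c p q r a' b' c' p' q' r' t
  assume G: "geodesic_triangle M d a b c p q r"
    and G': "geodesic_triangle (model_surface 0) (model_dist 0) a' b' c' p' q' r'"
    and eq: "model_dist 0 a' b' = d a b" "model_dist 0 b' c' = d b c" "model_dist 0 c' a' = d c a"
    and t: "t \<in> {0..d b c}"
  have M: "a \<in> M" "b \<in> M" "c \<in> M" and p: "geodesic M d b c p"
    using G by (auto simp: geodesic_triangle_def)
  have "geodesic (model_surface 0) dist b' c' p'"
    using G' by (auto simp: geodesic_triangle_def model_dist_0)
  then have m': "dist b' (p' t) = t" "dist (p' t) c' = d b c - t"
    using geodesic_dist[of _ dist b' c' p' t] t eq by (auto simp: model_dist_0)
  note m = geodesic_dist[OF p t]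
  have "d b c * (d (p t) a)\<^sup>2 \<le> d (p t) c * (d a b)\<^sup>2 + d b (p t) * (d c a)\<^sup>2 - d b (p t) * d (p t) c * d b c"
    using assms(2)[unfolded flat_ineq_def, rule_format, OF M m(1)] m by simp
  also have "\<dots> = d b c * (dist (p' t) a')\<^sup>2"
    using stewart[of b' "p' t" c' a'] m m' eq by (simp add: model_dist_0)
  finally have le: "d b c * (d (p t) a)\<^sup>2 \<le> d b c * (dist (p' t) a')\<^sup>2" .
  show "d (p t) a \<le> model_dist 0 (p' t) a'"
  \<comment> \<open>A degenerate side reduces the inequality to 0 \<le> 0; then both points are the
    vertices b and b'.\<close>
  proof (cases "d b c = 0")
    case True
    then have "b' = p' t" "b = p t" using t m m' M by auto
    then show ?thesis using eq by (simp add: model_dist_0 commute dist_commute)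
  next
    case False
    then have "(d (p t) a)\<^sup>2 \<le> (dist (p' t) a')\<^sup>2"
      using le nonneg[of b c] by (simp add: mult_le_cancel_left_pos less_le)
    then show ?thesis by (auto simp: model_dist_0 intro: power2_le_imp_le)
  qed
qed (use assms in auto)

text \<open>\<open>CAT\<close> says something only once a comparison triangle with all its sides is
  at hand, so one is constructed in the plane; \<open>stewart\<close> evaluates the distance in
  it.\<close>

lemma CAT_0_imp_flat_ineq:
  assumes "CAT 0 M d"
  shows "flat_ineq M d"
  unfolding flat_ineq_def
proof (intro ballI impI)
  have gs: "geodesic_space M d" using assms by (simp add: CAT_def)
  interpret Metric_space M d using gs by (simp add: geodesic_space_def)
  fix a b c z
  assume M: "a \<in> M" "b \<in> M" "c \<in> M" "z \<in> M" and btw: "d b z + d z c = d b c"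
  show "d b c * (d z a)\<^sup>2 \<le> d z c * (d a b)\<^sup>2 + d b z * (d c a)\<^sup>2 - d b z * d z c * d b c"
  proof (cases "d b c = 0")
    case True
    then have "d b z = 0" "d z c = 0" using btw nonneg[of b z] nonneg[of z c] by linarith+
    then show ?thesis using True by simp
  next
    case False
    obtain p where p: "geodesic M d b c p" "p (d b z) = z"
      using geodesic_through[OF gs M(2,3,4) btw] .
    obtain q r where qr: "geodesic M d c a q" "geodesic M d a b r"
      using gs M by (meson geodesic_space_def)
    obtain a' b' c' where M': "a' \<in> model_surface 0" "b' \<in> model_surface 0" "c' \<in> model_surface 0"
      and eq: "dist a' b' = d a b" "dist b' c' = d b c" "dist c' a' = d c a"
    proof (rule comparison_triangle_plane[of "d b c" "d a b" "d c a"])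
      show "d a b \<le> d c a + d b c" "d c a \<le> d a b + d b c" "d b c \<le> d a b + d c a"
        using triangle[OF M(1,3,2)] triangle[OF M(3,2,1)] triangle[OF M(2,1,3)]
          commute[of a b] commute[of b c] commute[of c a] by linarith+
    qed (use False M in auto)
    obtain p' q' r' where "geodesic (model_surface 0) (model_dist 0) b' c' p'"
      "geodesic (model_surface 0) (model_dist 0) c' a' q'" "geodesic (model_surface 0) (model_dist 0) a' b' r'"
      using geodesic_plane[OF M'(2,3)] geodesic_plane[OF M'(3,1)] geodesic_plane[OF M'(1,2)] by blast
    then have tri': "geodesic_triangle (model_surface 0) (model_dist 0) a' b' c' p' q' r'"
      and p': "geodesic (model_surface 0) dist b' c' p'"
      using M' by (auto simp: geodesic_triangle_def model_dist_0)
    have t: "d b z \<in> {0..d b c}" using btw nonneg[of b z] nonneg[of z c] unfolding atLeastAtMost_iff by linarith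
    have m': "dist b' (p' (d b z)) = d b z" "dist (p' (d b z)) c' = d z c"
      using geodesic_dist[OF p'] t eq btw by auto
    have "geodesic_triangle M d a b c p q r" using M p qr by (simp add: geodesic_triangle_def)
    then have "d (p (d b z)) a \<le> model_dist 0 (p' (d b z)) a'"
      using assms[unfolded CAT_def, THEN conjunct2, rule_format, of a b c p q r a' b' c' p' q' r'] tri' eq t
      by (simp add: model_dist_0)
    then have "(d z a)\<^sup>2 \<le> (dist (p' (d b z)) a')\<^sup>2"
      by (intro power_mono) (auto simp: p model_dist_0)
    then have "d b c * (d z a)\<^sup>2 \<le> d b c * (dist (p' (d b z)) a')\<^sup>2"
      by (intro mult_left_mono) auto
    also have "\<dots> = d z c * (d a b)\<^sup>2 + d b z * (d c a)\<^sup>2 - d b z * d z c * d b c"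
      using stewart[of b' "p' (d b z)" c' a'] m' eq btw by simp
    finally show ?thesis .
  qed
qed

section \<open>The spherical model\<close>

lemma model_surface_scaleR:
  assumes "0 < k" "norm v = 1"
  shows "(1 / sqrt k) *\<^sub>R v \<in> model_surface k"
  using assms by (simp add: model_surface_def)

lemma model_surface_cases:
  assumes "0 < k" "x \<in> model_surface k"
  obtains v where "norm v = 1" "x = (1 / sqrt k) *\<^sub>R v"
  using assms by (intro that[of "sqrt k *\<^sub>R x"]) (auto simp: model_surface_def)

lemma model_dist_scaleR:
  assumes "0 < k"
  shows "model_dist k ((1 / sqrt k) *\<^sub>R v) ((1 / sqrt k) *\<^sub>R w) = arccos (v \<bullet> w) / sqrt k"
proof -
  have "sqrt k * sqrt k = k" using assms by simp
  then have "k * (((1 / sqrt k) *\<^sub>R v) \<bullet> ((1 / sqrt k) *\<^sub>R w)) = v \<bullet> w"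
    using assms by (simp only: inner_scaleR_left inner_scaleR_right) (simp add: field_simps)
  then show ?thesis using assms by (simp add: model_dist_def)
qed

lemma great_circle_inner:
  fixes v n :: "'b::real_inner"
  assumes "v \<bullet> v = 1" "n \<bullet> n = 1" "v \<bullet> n = 0"
  shows "(cos s *\<^sub>R v + sin s *\<^sub>R n) \<bullet> (cos t *\<^sub>R v + sin t *\<^sub>R n) = cos (s - t)"
  using assms by (simp add: inner_add_left inner_add_right inner_commute[of n v] cos_diff)

lemma geodesic_great_circle:
  fixes v n :: "real^3"
  assumes k: "0 < k" and on: "v \<bullet> v = 1" "n \<bullet> n = 1" "v \<bullet> n = 0" and D: "0 \<le> D" "sqrt k * D \<le> pi"
  defines "\<gamma> \<equiv> \<lambda>t. (1 / sqrt k) *\<^sub>R (cos (sqrt k * t) *\<^sub>R v + sin (sqrt k * t) *\<^sub>R n)"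
  shows "model_dist k (\<gamma> 0) (\<gamma> D) = D" "geodesic (model_surface k) (model_dist k) (\<gamma> 0) (\<gamma> D) \<gamma>"
proof -
  have iso: "model_dist k (\<gamma> s) (\<gamma> t) = \<bar>s - t\<bar>" if "s \<in> {0..D}" "t \<in> {0..D}" for s t
  proof -
    have "\<bar>s - t\<bar> \<le> D" using that by (auto simp: abs_le_iff)
    then have "sqrt k * \<bar>s - t\<bar> \<le> sqrt k * D" using k by (intro mult_left_mono) auto
    then have "sqrt k * \<bar>s - t\<bar> \<le> pi" using D by linarith
    moreover have "sqrt k * \<bar>s - t\<bar> = \<bar>sqrt k * s - sqrt k * t\<bar>"
      using k by (simp add: abs_mult flip: right_diff_distrib)
    then have "cos (sqrt k * s - sqrt k * t) = cos (sqrt k * \<bar>s - t\<bar>)"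
      by simp
    ultimately show ?thesis
      unfolding \<gamma>_def model_dist_scaleR[OF k] great_circle_inner[OF on]
      using k by (simp add: arccos_cos)
  qed
  show *: "model_dist k (\<gamma> 0) (\<gamma> D) = D" using iso[of 0 D] D by simp
  have "norm (cos t *\<^sub>R v + sin t *\<^sub>R n) = 1" for t
    using great_circle_inner[OF on, of t t] by (simp add: norm_eq_sqrt_inner)
  then have "\<gamma> t \<in> model_surface k" for t
    unfolding \<gamma>_def using k by (intro model_surface_scaleR)
  then show "geodesic (model_surface k) (model_dist k) (\<gamma> 0) (\<gamma> D) \<gamma>"
    using iso by (auto simp: geodesic_def *)
qed

text \<open>The strict bound excludes antipodal points, which do not determine a great
  circle.\<close>

lemma geodesic_sphere:
  assumes k: "0 < k" and S: "x \<in> model_surface k" "y \<in> model_surface k"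
    and lt: "sqrt k * model_dist k x y < pi"
  shows "\<exists>p. geodesic (model_surface k) (model_dist k) x y p"
proof (cases "x = y")
  case True
  obtain v where "norm v = 1" "x = (1 / sqrt k) *\<^sub>R v" using model_surface_cases[OF k S(1)] .
  then have "model_dist k x x = 0" using k by (simp add: model_dist_scaleR dot_square_norm)
  then have "geodesic (model_surface k) (model_dist k) x y (\<lambda>_. x)"
    using True S by (auto simp: geodesic_def)
  then show ?thesis by blast
next
  case False
  obtain v where v: "norm v = 1" "x = (1 / sqrt k) *\<^sub>R v" using model_surface_cases[OF k S(1)] .
  obtain w where w: "norm w = 1" "y = (1 / sqrt k) *\<^sub>R w" using model_surface_cases[OF k S(2)] .
  define L where "L = arccos (v \<bullet> w)"
  have ip: "v \<bullet> v = 1" "w \<bullet> w = 1" "w \<bullet> v = v \<bullet> w"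
    using v w by (simp_all add: dot_square_norm inner_commute)
  have vw: "\<bar>v \<bullet> w\<bar> \<le> 1" using Cauchy_Schwarz_ineq2[of v w] v w by simp
  have D: "sqrt k * model_dist k x y = L"
    using k by (simp add: v w L_def model_dist_scaleR)
  have "v \<bullet> w \<noteq> 1"
  proof
    assume "v \<bullet> w = 1"
    then have "(v - w) \<bullet> (v - w) = 0" by (simp add: inner_diff_left inner_diff_right ip)
    then show False using False v w by simp
  qed
  then have L: "cos L = v \<bullet> w" "0 < L" "L < pi"
    using vw D lt arccos_lt_bounded[of "v \<bullet> w"] arccos_lbound[of "v \<bullet> w"] arccos_eq_0_iff[of "v \<bullet> w"]
    by (auto simp: L_def abs_le_iff less_le)
  then have sL: "0 < sin L" by (simp add: sin_gt_zero)
  \<comment> \<open>Gram-Schmidt: the unit direction at v of the great circle towards w. The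
    component of w orthogonal to v has length sin L.\<close>
  define n where "n = (1 / sin L) *\<^sub>R (w - cos L *\<^sub>R v)"
  have "v \<bullet> n = 0" by (simp add: n_def inner_diff_right ip L)
  moreover have "n \<bullet> n = 1"
  proof -
    have "(w - cos L *\<^sub>R v) \<bullet> (w - cos L *\<^sub>R v) = (sin L)\<^sup>2"
      by (simp add: inner_diff_left inner_diff_right ip sin_squared_eq)
        (simp add: power2_eq_square flip: L(1))
    then show ?thesis using sL by (simp add: n_def power2_eq_square)
  qed
  moreover have "cos L *\<^sub>R v + sin L *\<^sub>R n = w" using sL by (simp add: n_def)
  moreover have "sqrt k * (L / sqrt k) = L" using k by simp
  ultimately show ?thesis
    using geodesic_great_circle(2)[OF k ip(1), of n "L / sqrt k"] L k unfolding v w by auto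
qed

lemma CAT_imp_trig_ineq:
  assumes "CAT k M d" and k: "0 < k"
  shows "trig_ineq (sqrt k) M d"
  unfolding trig_ineq_def
proof (intro ballI impI)
  have gs: "geodesic_space M d" using assms by (simp add: CAT_def)
  interpret Metric_space M d using gs by (simp add: geodesic_space_def)
  fix a b c z
  assume M: "a \<in> M" "b \<in> M" "c \<in> M" "z \<in> M" and btw: "d b z + d z c = d b c"
    and per: "sqrt k * (d a b + d b c + d c a) < 2 * pi"
  define X L Y where "X = sqrt k * d a b" and "L = sqrt k * d b c" and "Y = sqrt k * d c a"
  have rk: "0 < sqrt k" using k by simp
  have tri: "d a b \<le> d b c + d c a" "d b c \<le> d c a + d a b" "d c a \<le> d a b + d b c"
    using triangle[OF M(1,3,2)] triangle[OF M(2,1,3)] triangle[OF M(3,2,1)]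
      commute[of a b] commute[of b c] commute[of c a] by linarith+
  have XLY: "X \<le> L + Y" "L \<le> Y + X" "Y \<le> X + L" "X + L + Y < 2 * pi" "0 \<le> X" "0 \<le> L" "0 \<le> Y"
    using tri[THEN mult_left_mono, of "sqrt k"] per rk by (auto simp: X_def L_def Y_def distrib_left)
  then have lt: "X < pi" "L < pi" "Y < pi" by linarith+
  show "sin (sqrt k * d z c) * cos (sqrt k * d a b) + sin (sqrt k * d b z) * cos (sqrt k * d c a)
       \<le> sin (sqrt k * d b c) * cos (sqrt k * d z a)"
  proof (cases "d b c = 0")
    case True
    then have "d b z = 0" "d z c = 0" using btw nonneg[of b z] nonneg[of z c] by linarith+
    then show ?thesis using True by simp
  next
    case False
    then have "0 < L" using rk nonneg[of b c] by (simp add: L_def less_le)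
    then have sL: "0 < sin L" using lt by (simp add: sin_gt_zero)
    \<comment> \<open>The comparison triangle has b' in direction (1, 0, 0), c' in direction (cos L,
      sin L, 0) and a' with first coordinate cos X; h is its second coordinate, forced by the inner
      product cos Y with c'.\<close>
    define h where "h = (cos Y - cos X * cos L) / sin L"
    have hL: "h * sin L = cos Y - cos X * cos L" using sL by (simp add: h_def)
    \<comment> \<open>Together with cos Y \<le> cos |X - L| this gives |h| \<le> sin X, so a' fits
      on the sphere. For X + L > pi it is the perimeter bound that gives Y < 2 pi - (X + L).\<close>
    have "cos (X + L) \<le> cos Y"
    proof (cases "X + L \<le> pi")
      case True
      then show ?thesis using XLY by (intro cos_monotone_0_pi_le) auto
    next
      case False
      then have "cos (2 * pi - (X + L)) \<le> cos Y" using XLY by (intro cos_monotone_0_pi_le) auto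
      then show ?thesis by (simp add: cos_diff)
    qed
    moreover have "cos Y \<le> cos \<bar>X - L\<bar>" using XLY lt by (intro cos_monotone_0_pi_le) auto
    ultimately have "\<bar>h * sin L\<bar> \<le> sin X * sin L"
      unfolding hL abs_le_iff by (simp add: cos_add cos_diff)
    then have "\<bar>h\<bar> \<le> sin X" using sL by (simp add: abs_mult)
    then have "h\<^sup>2 \<le> (sin X)\<^sup>2" using abs_le_square_iff[of h "sin X"] by linarith
    then have hX: "(cos X)\<^sup>2 + h\<^sup>2 \<le> 1" using sin_cos_squared_add[of X] by linarith
    define e n e' :: "real^3" where "e = vector [1, 0, 0]" and "n = vector [0, 1, 0]"
      and "e' = vector [cos X, h, sqrt (1 - ((cos X)\<^sup>2 + h\<^sup>2))]"
    have ip: "v \<bullet> w = v$1 * w$1 + v$2 * w$2 + v$3 * w$3" for v w :: "real^3"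
      by (simp add: inner_vec_def sum_3)
    have on: "e \<bullet> e = 1" "n \<bullet> n = 1" "e \<bullet> n = 0" "e' \<bullet> e = cos X" "e' \<bullet> n = h" "e' \<bullet> e' = 1"
      using hX by (simp_all add: ip e_def n_def e'_def vector_3 power2_eq_square)
    define \<gamma> where "\<gamma> t = (1 / sqrt k) *\<^sub>R (cos (sqrt k * t) *\<^sub>R e + sin (sqrt k * t) *\<^sub>R n)" for t
    define a' where "a' = (1 / sqrt k) *\<^sub>R e'"
    have D: "0 \<le> d b c" "sqrt k * d b c \<le> pi" using lt by (auto simp: L_def)
    have bc: "model_dist k (\<gamma> 0) (\<gamma> (d b c)) = d b c"
      "geodesic (model_surface k) (model_dist k) (\<gamma> 0) (\<gamma> (d b c)) \<gamma>"
      using geodesic_great_circle[OF k on(1-3) D] unfolding \<gamma>_def by auto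
    have a'\<gamma>: "model_dist k (\<gamma> t) a' = arccos (cos (sqrt k * t) * cos X + sin (sqrt k * t) * h) / sqrt k"
      "model_dist k a' (\<gamma> t) = arccos (cos (sqrt k * t) * cos X + sin (sqrt k * t) * h) / sqrt k" for t
      unfolding a'_def \<gamma>_def model_dist_scaleR[OF k] using on
      by (simp_all add: inner_add_left inner_add_right inner_commute[of e e'] inner_commute[of n e'])
    have ab: "model_dist k a' (\<gamma> 0) = d a b"
      unfolding a'\<gamma> using rk XLY lt by (simp add: arccos_cos) (simp add: X_def)
    have ca: "model_dist k (\<gamma> (d b c)) a' = d c a"
    proof -
      have "cos L * cos X + sin L * h = cos Y" using hL by (simp add: mult.commute)
      then have "arccos (cos L * cos X + sin L * h) = Y" using XLY lt by (simp add: arccos_cos)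
      then show ?thesis unfolding a'\<gamma> using rk by (simp add: L_def[symmetric]) (simp add: Y_def)
    qed
    have S: "a' \<in> model_surface k" "\<gamma> 0 \<in> model_surface k" "\<gamma> (d b c) \<in> model_surface k"
      using k on bc(2) D(1)
      by (auto simp: a'_def norm_eq_sqrt_inner geodesic_def bc intro!: model_surface_scaleR)
    obtain q' where q': "geodesic (model_surface k) (model_dist k) (\<gamma> (d b c)) a' q'"
      using geodesic_sphere[OF k S(3,1)] lt by (auto simp: ca Y_def)
    obtain r' where r': "geodesic (model_surface k) (model_dist k) a' (\<gamma> 0) r'"
      using geodesic_sphere[OF k S(1,2)] lt by (auto simp: ab X_def)
    obtain p where p: "geodesic M d b c p" "p (d b z) = z"
      using geodesic_through[OF gs M(2,3,4) btw] .
    obtain q r where qr: "geodesic M d c a q" "geodesic M d a b r"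
      using gs M by (meson geodesic_space_def)
    have T: "geodesic_triangle M d a b c p q r" using M p qr by (simp add: geodesic_triangle_def)
    have T': "geodesic_triangle (model_surface k) (model_dist k) a' (\<gamma> 0) (\<gamma> (d b c)) \<gamma> q' r'"
      using S bc q' r' by (simp add: geodesic_triangle_def)
    have per': "d a b + d b c + d c a < 2 * pi / sqrt k"
      using per rk by (simp add: field_simps)
    have t: "d b z \<in> {0..d b c}" using btw nonneg[of b z] nonneg[of z c]
      unfolding atLeastAtMost_iff by linarith
    \<comment> \<open>The cosine of the scaled distance from a' to the comparison point, so
      \<open>CAT\<close> becomes a lower bound for cos(sqrt k \<open>d z a\<close>).\<close>
    define g where "g = cos (sqrt k * d b z) * cos X + sin (sqrt k * d b z) * h"
    have "d z a \<le> model_dist k (\<gamma> (d b z)) a'"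
      using assms(1)[unfolded CAT_def, THEN conjunct2, rule_format,
          of a b c p q r a' "\<gamma> 0" "\<gamma> (d b c)" \<gamma> q' r' "d b z"] T T' per' ab bc(1) ca t p(2) by simp
    then have le: "sqrt k * d z a \<le> arccos g"
      using rk by (simp add: a'\<gamma> g_def field_simps)
    have "\<bar>g\<bar> \<le> 1"
    proof -
      have "(cos (sqrt k * d b z) *\<^sub>R e + sin (sqrt k * d b z) *\<^sub>R n) \<bullet> e' = g"
        using on by (simp add: g_def inner_add_left inner_commute[of e e'] inner_commute[of n e'])
      moreover have "norm (cos (sqrt k * d b z) *\<^sub>R e + sin (sqrt k * d b z) *\<^sub>R n) = 1"
        using great_circle_inner[OF on(1-3), of "sqrt k * d b z" "sqrt k * d b z"]
        by (simp add: norm_eq_sqrt_inner)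
      moreover have "norm e' = 1" using on by (simp add: norm_eq_sqrt_inner)
      ultimately show ?thesis
        using Cauchy_Schwarz_ineq2[of "cos (sqrt k * d b z) *\<^sub>R e + sin (sqrt k * d b z) *\<^sub>R n" e'] by simp
    qed
    then have "g \<le> cos (sqrt k * d z a)"
      using cos_monotone_0_pi_le[OF _ le] arccos_ubound[of g] rk by (auto simp: abs_le_iff)
    then have "sin L * g \<le> sin L * cos (sqrt k * d z a)" using sL by (intro mult_left_mono) auto
    moreover have "sin L * g = sin (sqrt k * d z c) * cos X + sin (sqrt k * d b z) * cos Y"
    proof -
      have "sqrt k * d z c = L - sqrt k * d b z" by (simp add: L_def distrib_left flip: btw)
      then have sz: "sin (sqrt k * d z c) = sin L * cos (sqrt k * d b z) - cos L * sin (sqrt k * d b z)"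
        by (simp add: sin_diff)
      have cY: "cos Y = cos X * cos L + h * sin L" using hL by simp
      show ?thesis unfolding sz cY g_def by (simp add: algebra_simps)
    qed
    ultimately show ?thesis by (simp add: X_def L_def Y_def)
  qed
qed

section \<open>Polar coordinates\<close>

text \<open>The Euclidean law of cosines. The cone metric is half of it, evaluated at the truncated
  angle.\<close>

definition polar_dist :: "real \<Rightarrow> real \<Rightarrow> real \<Rightarrow> real" where
  "polar_dist s t \<theta> = sqrt (s\<^sup>2 + t\<^sup>2 - 2 * s * t * cos \<theta>)"

lemma polar_dist_alt: "(s::real)\<^sup>2 + t\<^sup>2 - 2 * s * t * cos \<theta> = (s - t * cos \<theta>)\<^sup>2 + (t * sin \<theta>)\<^sup>2"
proof -
  have "(s - t * cos \<theta>)\<^sup>2 + (t * sin \<theta>)\<^sup>2 = s\<^sup>2 - 2 * s * t * cos \<theta> + t\<^sup>2 * ((sin \<theta>)\<^sup>2 + (cos \<theta>)\<^sup>2)"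
    by (simp add: power2_eq_square algebra_simps del: sin_cos_squared_add3)
  then show ?thesis by simp
qed

lemma polar_dist_nonneg: "0 \<le> polar_dist s t \<theta>"
  unfolding polar_dist_def polar_dist_alt by simp

lemma polar_dist_square: "(polar_dist s t \<theta>)\<^sup>2 = s\<^sup>2 + t\<^sup>2 - 2 * s * t * cos \<theta>"
  unfolding polar_dist_def polar_dist_alt by simp

lemma dist_rcis: "dist (rcis s \<alpha>) (rcis t \<gamma>) = polar_dist s t (\<alpha> - \<gamma>)"
proof -
  have "(s * cos \<alpha> - t * cos \<gamma>)\<^sup>2 + (s * sin \<alpha> - t * sin \<gamma>)\<^sup>2 =
      s\<^sup>2 * ((sin \<alpha>)\<^sup>2 + (cos \<alpha>)\<^sup>2) + t\<^sup>2 * ((sin \<gamma>)\<^sup>2 + (cos \<gamma>)\<^sup>2) - 2 * s * t * cos (\<alpha> - \<gamma>)"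
    by (simp add: power2_eq_square algebra_simps cos_diff del: sin_cos_squared_add3)
  then show ?thesis by (simp add: dist_norm cmod_def polar_dist_def)
qed

lemma polar_dist_mono:
  assumes "0 \<le> s" "0 \<le> t" "0 \<le> \<theta>" "\<theta> \<le> \<phi>" "\<phi> \<le> pi"
  shows "polar_dist s t \<theta> \<le> polar_dist s t \<phi>"
proof -
  have "s * t * cos \<phi> \<le> s * t * cos \<theta>"
    using assms by (intro mult_left_mono cos_monotone_0_pi_le) auto
  then show ?thesis by (simp add: polar_dist_def)
qed

text \<open>The angle \<alpha> is lowered to \<delta> so that l \<le> \<delta> + \<gamma> \<le> pi.
  Three points of the plane with angles \<delta> and \<gamma> between neighbours satisfy the
  inequality, and \<open>polar_dist\<close> is monotone in the angle on [0, pi].\<close>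

lemma polar_dist_triangle:
  assumes "0 \<le> r" "0 \<le> s" "0 \<le> t" "0 \<le> l" "l \<le> pi" "0 \<le> \<alpha>" "\<alpha> \<le> pi" "0 \<le> \<gamma>" "\<gamma> \<le> pi" "l \<le> \<alpha> + \<gamma>"
  shows "polar_dist s t l \<le> polar_dist s r \<alpha> + polar_dist r t \<gamma>"
proof -
  define \<delta> where "\<delta> = min \<alpha> (pi - \<gamma>)"
  have \<delta>: "0 \<le> \<delta>" "\<delta> \<le> \<alpha>" "\<delta> + \<gamma> \<le> pi" "l \<le> \<delta> + \<gamma>" using assms by (auto simp: \<delta>_def min_def)
  have "polar_dist s t l \<le> polar_dist s t (\<delta> + \<gamma>)" using assms \<delta> by (intro polar_dist_mono) auto
  also have "\<dots> = dist (rcis s (\<delta> + \<gamma>)) (rcis t 0)" unfolding dist_rcis by simp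
  also have "\<dots> \<le> dist (rcis s (\<delta> + \<gamma>)) (rcis r \<gamma>) + dist (rcis r \<gamma>) (rcis t 0)"
    by (rule dist_triangle)
  also have "\<dots> = polar_dist s r \<delta> + polar_dist r t \<gamma>" unfolding dist_rcis by simp
  also have "polar_dist s r \<delta> \<le> polar_dist s r \<alpha>" using assms \<delta> by (intro polar_dist_mono) auto
  finally show ?thesis by simp
qed

lemma polar_dist_eq_0:
  assumes "0 \<le> s" "0 \<le> t" "0 \<le> \<theta>" "\<theta> \<le> pi"
  shows "polar_dist s t \<theta> = 0 \<longleftrightarrow> s = t \<and> (s = 0 \<or> \<theta> = 0)"
proof -
  have e: "s\<^sup>2 + t\<^sup>2 - 2 * s * t * cos \<theta> = (s - t)\<^sup>2 + 2 * (s * t * (1 - cos \<theta>))"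
    by (simp add: power2_eq_square algebra_simps)
  have "0 \<le> s * t * (1 - cos \<theta>)" using assms by simp
  then have "polar_dist s t \<theta> = 0 \<longleftrightarrow> s = t \<and> s * t * (1 - cos \<theta>) = 0"
    unfolding polar_dist_def e real_sqrt_eq_0_iff by (smt (verit) zero_le_power2 power2_eq_iff_nonneg zero_eq_power2)
  also have "1 - cos \<theta> = 0 \<longleftrightarrow> \<theta> = 0"
    using assms cos_inj_pi[of \<theta> 0] by auto
  then have "(s = t \<and> s * t * (1 - cos \<theta>) = 0) \<longleftrightarrow> s = t \<and> (s = 0 \<or> \<theta> = 0)" by auto
  finally show ?thesis .
qed

text \<open>A sector of angle below pi is convex. The argument of z is located by the signs of the
  imaginary parts of z and of z rotated back by L.\<close>

lemma sector_polar:
  assumes L: "0 \<le> L" "L < pi" and s: "0 \<le> s" and t: "0 \<le> t"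
    and z: "z \<in> closed_segment (rcis s 0) (rcis t L)"
  shows "\<exists>\<phi>\<in>{0..L}. z = rcis (cmod z) \<phi>"
proof (cases "z = 0")
  case True
  then show ?thesis using L by (intro bexI[of _ 0]) auto
next
  case False
  obtain m where m: "0 \<le> m" "m \<le> 1" "z = (1 - m) *\<^sub>R rcis s 0 + m *\<^sub>R rcis t L"
    using z by (auto simp: in_segment)
  have pz: "z = rcis (cmod z) (Arg z)" by (simp add: rcis_cmod_Arg)
  have sinL: "0 \<le> sin L" using L by (simp add: sin_ge_zero)
  have im: "Im z = m * (t * sin L)" and re: "Re z = (1 - m) * s + m * (t * cos L)" using m by simp_all
  have Arg: "- pi < Arg z" "Arg z \<le> pi" using Arg_bounded by auto
  have "0 \<le> Im z" using m t sinL im by simp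
  moreover have imA: "Im z = cmod z * sin (Arg z)" using arg_cong[OF pz, of Im] by simp
  ultimately have "0 \<le> sin (Arg z)" using False by (simp add: zero_le_mult_iff)
  then have A0: "0 \<le> Arg z"
    using Arg sin_gt_zero[of "- Arg z"] by (cases "Arg z < 0") auto
  have reA: "Re z = cmod z * cos (Arg z)" using arg_cong[OF pz, of Re] by simp
  have "cmod z * sin (Arg z - L) = Im z * cos L - Re z * sin L"
    unfolding imA reA by (simp add: sin_diff algebra_simps)
  also have "\<dots> = - ((1 - m) * (s * sin L))" unfolding im re by (simp add: algebra_simps)
  also have "\<dots> \<le> 0" using m s sinL by simp
  finally have "sin (Arg z - L) \<le> 0" using False by (simp add: mult_le_0_iff)
  then have "\<not> (0 < Arg z - L \<and> Arg z - L < pi)" using sin_gt_zero[of "Arg z - L"] by linarith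
  then have "Arg z \<le> L \<or> L = 0 \<and> Arg z = pi" using Arg L by linarith
  \<comment> \<open>For L = 0 both signs also admit the opposite ray; the real part rules it
    out.\<close>
  moreover have "Arg z \<noteq> pi" if "L = 0"
  proof
    assume "Arg z = pi"
    then have "Re z = - cmod z" using reA by simp
    moreover have "0 \<le> Re z" using re m s t that by simp
    ultimately show False using False by simp
  qed
  ultimately have "Arg z \<le> L" by blast
  with A0 pz show ?thesis by auto
qed

section \<open>Concavity of the cone inner product\<close>

text \<open>The points \<open>(1 - \<lambda>) B\<close> and \<open>\<lambda> C\<close> of the cone have norms \<open>S\<close>, \<open>T\<close> and angle \<open>l\<close>;
  \<open>r\<close> is the norm of the point dividing \<open>B C\<close>, at angles \<open>\<alpha>\<close>, \<open>\<gamma>\<close> from \<open>B\<close>, \<open>C\<close>.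
  The quadratic equation for \<open>r\<close> has no solution unless the configuration is planar.\<close>

lemma cone_point_planar:
  assumes nn: "0 < S" "0 < T" "0 \<le> r"
    and ang: "0 \<le> l" "l \<le> pi" "0 \<le> \<alpha>" "\<alpha> \<le> pi" "0 \<le> \<gamma>" "\<gamma> \<le> pi" "l \<le> \<alpha> + \<gamma>"
    and eq: "r\<^sup>2 - 2 * r * (S * cos \<alpha> + T * cos \<gamma>) + (S\<^sup>2 + T\<^sup>2 + 2 * S * T * cos l) = 0"
  shows "r\<^sup>2 = S\<^sup>2 + T\<^sup>2 + 2 * S * T * cos l"
    and "r = 0 \<and> S = T \<and> l = pi \<or>
      0 < r \<and> \<alpha> + \<gamma> = l \<and> r = S * cos \<alpha> + T * cos \<gamma> \<and> S * sin \<alpha> = T * sin \<gamma>"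
proof -
  \<comment> \<open>The length of the sum of two plane vectors of lengths S and T at angle l, that
    is, the radius a planar dividing point would have.\<close>
  define q where "q = sqrt (S\<^sup>2 + T\<^sup>2 + 2 * S * T * cos l)"
  have q_alt: "S\<^sup>2 + T\<^sup>2 + 2 * S * T * cos l = (S - T)\<^sup>2 + 2 * (S * T * (1 + cos l))"
    by (simp add: power2_eq_square algebra_simps)
  have c1: "0 \<le> 1 + cos l" using cos_ge_minus_one[of l] by linarith
  have "0 \<le> S * T * (1 + cos l)" using nn c1 by simp
  then have q2: "q\<^sup>2 = S\<^sup>2 + T\<^sup>2 + 2 * S * T * cos l" and q0: "0 \<le> q"
    unfolding q_def q_alt by simp_all
  define k where "k \<delta> = S * cos \<delta> + T * cos \<gamma>" for \<delta>
  \<comment> \<open>If \<delta> + \<gamma> = l, then \<open>k \<delta>\<close> is the projection of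
    the sum vector to a ray between the two vectors, and the square is its perpendicular part; a
    larger \<delta> + \<gamma> adds the second term.\<close>
  have gap: "q\<^sup>2 - (k \<delta>)\<^sup>2 = (S * sin \<delta> - T * sin \<gamma>)\<^sup>2 + 2 * (S * T * (cos l - cos (\<delta> + \<gamma>)))" for \<delta>
  proof -
    have "(S * sin \<delta> - T * sin \<gamma>)\<^sup>2 + (k \<delta>)\<^sup>2 =
        S\<^sup>2 * ((sin \<delta>)\<^sup>2 + (cos \<delta>)\<^sup>2) + T\<^sup>2 * ((sin \<gamma>)\<^sup>2 + (cos \<gamma>)\<^sup>2) + 2 * (S * T * cos (\<delta> + \<gamma>))"
      unfolding k_def
      by (simp add: power2_eq_square algebra_simps cos_add del: sin_cos_squared_add3)
    then show ?thesis unfolding q2 by (simp add: algebra_simps)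
  qed
  have kq: "k \<delta> \<le> q" if "0 \<le> \<delta>" "l \<le> \<delta> + \<gamma>" "\<delta> + \<gamma> \<le> pi" for \<delta>
  proof -
    have "cos (\<delta> + \<gamma>) \<le> cos l" using that ang by (intro cos_monotone_0_pi_le) auto
    then have "0 \<le> q\<^sup>2 - (k \<delta>)\<^sup>2" unfolding gap using nn by simp
    then show ?thesis using q0 by (intro power2_le_imp_le[of "k \<delta>" q]) auto
  qed
  define \<delta> where "\<delta> = min \<alpha> (pi - \<gamma>)"
  have \<delta>: "0 \<le> \<delta>" "\<delta> \<le> \<alpha>" "\<delta> + \<gamma> \<le> pi" "l \<le> \<delta> + \<gamma>" using ang by (auto simp: \<delta>_def min_def)
  have "cos \<alpha> \<le> cos \<delta>" using \<delta> ang by (intro cos_monotone_0_pi_le) auto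
  then have "S * cos \<alpha> \<le> S * cos \<delta>" using nn by simp
  then have k\<alpha>: "k \<alpha> \<le> k \<delta>" by (simp add: k_def)
  have kle: "k \<alpha> \<le> q" using k\<alpha> kq[OF \<delta>(1,4,3)] by linarith
  \<comment> \<open>The equation becomes a sum of two nonnegative terms, so both vanish.\<close>
  have "(r - q)\<^sup>2 + 2 * (r * (q - k \<alpha>)) = 0"
    using eq unfolding q2[symmetric] k_def[symmetric] by (simp add: power2_eq_square algebra_simps)
  moreover have "0 \<le> r * (q - k \<alpha>)" using nn kle by simp
  ultimately have "(r - q)\<^sup>2 = 0" "r * (q - k \<alpha>) = 0"
    using zero_le_power2[of "r - q"] by linarith+
  then have rq: "r = q" and "r = 0 \<or> q = k \<alpha>" by auto
  show "r\<^sup>2 = S\<^sup>2 + T\<^sup>2 + 2 * S * T * cos l" using rq q2 by simp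
  show "r = 0 \<and> S = T \<and> l = pi \<or>
      0 < r \<and> \<alpha> + \<gamma> = l \<and> r = S * cos \<alpha> + T * cos \<gamma> \<and> S * sin \<alpha> = T * sin \<gamma>"
  proof (cases "r = 0")
    case True
    then have "(S - T)\<^sup>2 + 2 * (S * T * (1 + cos l)) = 0" using rq q2 q_alt by simp
    then have "(S - T)\<^sup>2 = 0" "S * T * (1 + cos l) = 0"
      using \<open>0 \<le> S * T * (1 + cos l)\<close> zero_le_power2[of "S - T"] by linarith+
    then have "S = T" "cos l = cos pi" using nn by auto
    then show ?thesis using True ang cos_inj_pi[of l pi] by auto
  next
    case False
    then have qk: "q = k \<alpha>" using \<open>r = 0 \<or> q = k \<alpha>\<close> by simp
    then have "k \<delta> = k \<alpha>" using k\<alpha> kq[OF \<delta>(1,4,3)] by linarith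
    then have "cos \<delta> = cos \<alpha>" using nn by (simp add: k_def)
    then have \<delta>\<alpha>: "\<delta> = \<alpha>" using cos_inj_pi[of \<delta> \<alpha>] \<delta> ang by auto
    then have le: "\<alpha> + \<gamma> \<le> pi" using \<delta> by simp
    then have "cos (\<alpha> + \<gamma>) \<le> cos l" using ang by (intro cos_monotone_0_pi_le) auto
    then have "0 \<le> S * T * (cos l - cos (\<alpha> + \<gamma>))" using nn by simp
    moreover have "(S * sin \<alpha> - T * sin \<gamma>)\<^sup>2 + 2 * (S * T * (cos l - cos (\<alpha> + \<gamma>))) = 0"
      using gap[of \<alpha>] qk by simp
    ultimately have "(S * sin \<alpha> - T * sin \<gamma>)\<^sup>2 = 0" "S * T * (cos l - cos (\<alpha> + \<gamma>)) = 0"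
      using zero_le_power2[of "S * sin \<alpha> - T * sin \<gamma>"] by linarith+
    then have "S * sin \<alpha> = T * sin \<gamma>" "cos l = cos (\<alpha> + \<gamma>)" using nn by auto
    moreover then have "\<alpha> + \<gamma> = l" using cos_inj_pi[of l "\<alpha> + \<gamma>"] ang le by auto
    ultimately show ?thesis using False nn(3) rq qk by (auto simp: k_def)
  qed
qed

text \<open>The case in which one endpoint has weight or radius 0: the equation then says that a
  polar distance is 0.\<close>

lemma cone_point_radial:
  assumes "0 \<le> r" "0 \<le> \<gamma>" "\<gamma> \<le> pi" and T: "0 \<le> T" and eq: "r\<^sup>2 - 2 * r * (T * cos \<gamma>) + T\<^sup>2 = 0"
  shows "r = T \<and> (T = 0 \<or> \<gamma> = 0)"
proof -
  have "polar_dist r T \<gamma> = 0" using eq by (simp add: polar_dist_def algebra_simps)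
  then show ?thesis using polar_dist_eq_0[of r T \<gamma>] assms by auto
qed

text \<open>Here x, y, u are the angles from a further point to B, C and the dividing point. For 0 <
  l < pi the law of sines turns sin l times the claim into r times \<open>trig\<close>. For l = 0
  all directions agree, and for l = pi the bound cos x + cos y \<le> 0 suffices.\<close>

lemma cone_inner_concave:
  assumes nn: "0 \<le> S" "0 \<le> T" "0 \<le> r"
    and ang: "0 \<le> l" "l \<le> pi" "0 \<le> \<alpha>" "\<alpha> \<le> pi" "0 \<le> \<gamma>" "\<gamma> \<le> pi" "l \<le> \<alpha> + \<gamma>"
    and eq: "r\<^sup>2 - 2 * r * (S * cos \<alpha> + T * cos \<gamma>) + (S\<^sup>2 + T\<^sup>2 + 2 * S * T * cos l) = 0"
    and xy: "0 \<le> x" "x \<le> pi" "0 \<le> y" "y \<le> pi" "l \<le> x + y"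
    and eqs: "\<alpha> = 0 \<Longrightarrow> u = x" "\<gamma> = 0 \<Longrightarrow> u = y"
    and trig: "0 < l \<Longrightarrow> l < pi \<Longrightarrow> \<alpha> + \<gamma> = l \<Longrightarrow> sin \<gamma> * cos x + sin \<alpha> * cos y \<le> sin l * cos u"
  shows "r\<^sup>2 = S\<^sup>2 + T\<^sup>2 + 2 * S * T * cos l \<and> S * cos x + T * cos y \<le> r * cos u"
proof -
  have sumcos: "cos x + cos y \<le> 0" if "l = pi"
    using cos_monotone_0_pi_le[of "pi - y" x] xy that by simp
  consider "S = 0" | "T = 0" | "0 < S" "0 < T" using nn by linarith
  then show ?thesis
  proof cases
    case 1
    then show ?thesis using cone_point_radial[of r \<gamma> T] nn ang eq eqs by auto
  next
    case 2
    then show ?thesis using cone_point_radial[of r \<alpha> S] nn ang eq eqs by auto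
  next
    case 3
    note pl = cone_point_planar[OF 3 nn(3) ang eq]
    from pl(2) show ?thesis
    proof (elim disjE conjE)
      assume "r = 0" "S = T" "l = pi"
      then have "S * (cos x + cos y) \<le> 0" using sumcos 3 by (simp add: mult_le_0_iff)
      with pl(1) \<open>r = 0\<close> \<open>S = T\<close> show ?thesis by (simp add: distrib_left)
    next
      assume *: "0 < r" "\<alpha> + \<gamma> = l" "r = S * cos \<alpha> + T * cos \<gamma>" "S * sin \<alpha> = T * sin \<gamma>"
      consider "l = 0" | "l = pi" | "0 < l" "l < pi" using ang by linarith
      then have "S * cos x + T * cos y \<le> r * cos u"
      proof cases
        case 1
        then have "\<alpha> = 0" "\<gamma> = 0" using * ang by linarith+
        then show ?thesis using * eqs by (simp add: distrib_right)
      next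
        case 2
        then have "\<gamma> = pi - \<alpha>" using * by simp
        then have "sin \<gamma> = sin \<alpha>" "cos \<gamma> = - cos \<alpha>" by simp_all
        then have "S * sin \<alpha> = T * sin \<alpha>" and r: "r = (S - T) * cos \<alpha>"
          using *(3,4) by (simp_all add: algebra_simps)
        \<comment> \<open>Otherwise S = T, and the segment would meet the apex, with r = 0.\<close>
        then have "sin \<alpha> = 0" using *(1) by auto
        then have "\<alpha> = 0 \<or> \<alpha> = pi" using ang sin_gt_zero[of \<alpha>] by (cases "\<alpha> = 0 \<or> \<alpha> = pi") auto
        then show ?thesis
        proof
          assume "\<alpha> = 0"
          then have "r * cos u = S * cos x - T * cos x" unfolding r using eqs by (simp add: left_diff_distrib)
          moreover have "T * (cos x + cos y) \<le> 0" using sumcos[OF 2] 3 by (simp add: mult_le_0_iff)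
          ultimately show ?thesis by (simp add: algebra_simps)
        next
          assume "\<alpha> = pi"
          then have "r * cos u = T * cos y - S * cos y"
            unfolding r using eqs \<open>\<gamma> = _\<close> by (simp add: left_diff_distrib)
          moreover have "S * (cos x + cos y) \<le> 0" using sumcos[OF 2] 3 by (simp add: mult_le_0_iff)
          ultimately show ?thesis by (simp add: algebra_simps)
        qed
      next
        case 3
        have sl: "sin l = sin \<alpha> * cos \<gamma> + cos \<alpha> * sin \<gamma>" using *(2) sin_add[of \<alpha> \<gamma>] by simp
        \<comment> \<open>The law of sines for the plane triangle with sides S, T, r.\<close>
        have "r * sin \<gamma> = (S * cos \<alpha>) * sin \<gamma> + (T * sin \<gamma>) * cos \<gamma>"
          unfolding *(3) by (simp add: algebra_simps)
        also have "\<dots> = S * sin l" unfolding *(4)[symmetric] sl by (simp add: algebra_simps)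
        finally have rS: "S * sin l = r * sin \<gamma>" by simp
        have "r * sin \<alpha> = (S * sin \<alpha>) * cos \<alpha> + (T * cos \<gamma>) * sin \<alpha>"
          unfolding *(3) by (simp add: algebra_simps)
        also have "\<dots> = T * sin l" unfolding *(4) sl by (simp add: algebra_simps)
        finally have rT: "T * sin l = r * sin \<alpha>" by simp
        have "sin l * (S * cos x + T * cos y) = (S * sin l) * cos x + (T * sin l) * cos y"
          by (simp add: algebra_simps)
        also have "\<dots> = r * (sin \<gamma> * cos x + sin \<alpha> * cos y)"
          unfolding rS rT by (simp add: algebra_simps)
        also have "\<dots> \<le> r * (sin l * cos u)" using trig[OF 3 *(2)] *(1) by simp
        finally have "sin l * (S * cos x + T * cos y) \<le> sin l * (r * cos u)" by (simp add: algebra_simps)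
        then show ?thesis using sin_gt_zero[OF 3] by simp
      qed
      with pl(1) show ?thesis by blast
    qed
  qed
qed

text \<open>Here no spherical comparison triangle exists; after decreasing \<open>x\<close> or \<open>y\<close> it degenerates.\<close>

lemma trig_ineq_large_perimeter:
  fixes l :: real
  assumes "0 < l" "l < pi" "\<alpha> + \<gamma> = l" "0 \<le> \<alpha>" "0 \<le> \<gamma>" "0 \<le> x" "x \<le> pi" "0 \<le> y" "y \<le> pi"
    "0 \<le> u" "u \<le> pi" "2 * pi \<le> x + y + l" "u \<le> x + \<alpha>" "u \<le> y + \<gamma>"
  shows "sin \<gamma> * cos x + sin \<alpha> * cos y \<le> sin l * cos u"
proof -
  have one: "sin \<gamma>' * cos x' + sin \<alpha>' * cos y' \<le> sin l * cos u"
    if "\<alpha>' + \<gamma>' = l" "0 \<le> \<alpha>'" "0 \<le> \<gamma>'" "0 \<le> x'" "x' \<le> pi" "0 \<le> y'" "y' \<le> pi"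
      "2 * pi \<le> x' + y' + l" "u \<le> x' + \<alpha>'" "x' + \<alpha>' \<le> pi" for \<alpha>' \<gamma>' x' y'
  proof -
    \<comment> \<open>Lowering y' to 2 pi - (x' + l) makes the perimeter exactly 2 pi. The triangle
      becomes a great circle, on which a and z have distance x' + \<alpha>'.\<close>
    have "cos y' \<le> cos (2 * pi - (x' + l))"
      using that assms by (intro cos_monotone_0_pi_le) auto
    also have "\<dots> = cos (x' + l)" by (simp add: cos_diff)
    finally have "sin \<alpha>' * cos y' \<le> sin \<alpha>' * cos (x' + l)"
      using that assms by (intro mult_left_mono sin_ge_zero) auto
    moreover have "sin \<gamma>' * cos x' + sin \<alpha>' * cos (x' + l) = sin l * cos (x' + \<alpha>')"
    proof -
      have g: "\<gamma>' = l - \<alpha>'" using that by simp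
      have "sin \<alpha>' * sin l * sin x' + cos l * (sin \<alpha>' * cos x') = sin \<alpha>' * (sin l * sin x' + cos l * cos x')"
        by (simp add: algebra_simps)
      then show ?thesis unfolding g by (simp add: sin_diff cos_add algebra_simps)
    qed
    moreover have "cos (x' + \<alpha>') \<le> cos u" using that assms by (intro cos_monotone_0_pi_le) auto
    then have "sin l * cos (x' + \<alpha>') \<le> sin l * cos u"
      using assms by (intro mult_left_mono sin_ge_zero) auto
    ultimately show ?thesis by linarith
  qed
  consider "x + \<alpha> \<le> pi" | "y + \<gamma> \<le> pi" | "pi < x + \<alpha>" "pi < y + \<gamma>" by linarith
  then show ?thesis
  proof cases
    case 1
    then show ?thesis using one[of \<alpha> \<gamma> x y] assms by auto
  next
    case 2
    then show ?thesis using one[of \<gamma> \<alpha> y x] assms by auto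
  next
    case 3
    \<comment> \<open>Lowering x to pi - \<alpha> and y to pi - \<gamma> places a antipodal to z,
      which gives the least possible value, -sin l.\<close>
    have "cos x \<le> cos (pi - \<alpha>)" "cos y \<le> cos (pi - \<gamma>)"
      using 3 assms by (intro cos_monotone_0_pi_le; simp)+
    then have "sin \<gamma> * cos x + sin \<alpha> * cos y \<le> sin \<gamma> * cos (pi - \<alpha>) + sin \<alpha> * cos (pi - \<gamma>)"
      using assms by (intro add_mono mult_left_mono sin_ge_zero) auto
    also have "\<dots> = - sin l" using assms(3) sin_add[of \<alpha> \<gamma>] by (simp add: algebra_simps)
    also have "\<dots> \<le> sin l * cos u"
      using mult_left_mono[OF cos_ge_minus_one[of u] sin_ge_zero[of l]] assms by simp
    finally show ?thesis .
  qed
qed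

section \<open>The cone as a metric space\<close>

locale metric_cone_space = Metric_space M d for M :: "'a set" and d +
  fixes \<beta> :: real
  assumes beta_pos: "0 < \<beta>"
begin

definition ang :: "'a \<Rightarrow> 'a \<Rightarrow> real" where
  "ang x y = pi * min (d x y / \<beta>) 1"

definition point :: "'a \<Rightarrow> real \<Rightarrow> ('a \<times> real) set" where
  "point x s = cone_rel M `` {(x, s)}"

abbreviation "K \<equiv> metric_cone M"
abbreviation "D \<equiv> cone_dist \<beta> d"

lemma ang_range: "0 \<le> ang x y" "ang x y \<le> pi"
  using beta_pos by (auto simp: ang_def mult_le_cancel_left1)

lemma ang_commute: "ang x y = ang y x"
  by (simp add: ang_def commute)

lemma ang_eq_0: "x \<in> M \<Longrightarrow> y \<in> M \<Longrightarrow> ang x y = 0 \<longleftrightarrow> x = y"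
  using beta_pos by (auto simp: ang_def min_def)

lemma ang_eq_min: "ang x y = min (pi / \<beta> * d x y) pi"
  using beta_pos by (auto simp: ang_def min_def field_simps)

lemma ang_triangle:
  assumes "x \<in> M" "y \<in> M" "z \<in> M"
  shows "ang x z \<le> ang x y + ang y z"
proof -
  have "pi / \<beta> * d x z \<le> pi / \<beta> * (d x y + d y z)"
    using triangle[OF assms] beta_pos by (intro mult_left_mono) auto
  moreover have "0 \<le> pi / \<beta> * d x y" "0 \<le> pi / \<beta> * d y z" using beta_pos by auto
  ultimately show ?thesis unfolding ang_eq_min distrib_left min_def using pi_gt_zero by argo
qed

lemma cone_cases:
  assumes "C \<in> K"
  obtains x s where "x \<in> M" "s \<in> {0..1}" "C = point x s"
  using assms unfolding metric_cone_def point_def by (auto elim!: quotientE)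

lemma point_in_cone: "x \<in> M \<Longrightarrow> s \<in> {0..1} \<Longrightarrow> point x s \<in> K"
  unfolding metric_cone_def point_def by (intro quotientI) auto

lemma point_zero: "x \<in> M \<Longrightarrow> y \<in> M \<Longrightarrow> point x 0 = point y 0"
  by (auto simp: point_def cone_rel_def)

lemma dist_point:
  assumes "x \<in> M" "y \<in> M" "s \<in> {0..1}" "t \<in> {0..1}"
  shows "D (point x s) (point y t) = polar_dist s t (ang x y) / 2"
  using assms unfolding point_def
  by (subst cone_dist_class) (auto simp: precone_dist_def polar_dist_def ang_def algebra_simps)

lemma dist_point_square:
  assumes "x \<in> M" "y \<in> M" "s \<in> {0..1}" "t \<in> {0..1}"
  shows "4 * (D (point x s) (point y t))\<^sup>2 = s\<^sup>2 + t\<^sup>2 - 2 * s * t * cos (ang x y)"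
  using assms by (simp add: dist_point power_divide polar_dist_square)

lemma cone_dist_nonneg: "0 \<le> D A B"
proof -
  have "0 \<le> precone_dist \<beta> d u v" for u v
    using polar_dist_nonneg[of "snd v" "snd u" "ang (fst u) (fst v)"]
    by (auto simp: precone_dist_def polar_dist_def ang_def split: prod.splits)
  then show ?thesis by (simp add: cone_dist_def)
qed

lemma cone_dist_commute: "D A B = D B A"
proof -
  have "precone_dist \<beta> d u v = precone_dist \<beta> d v u" for u v
    by (auto simp: precone_dist_def commute algebra_simps split: prod.splits)
  then show ?thesis by (simp add: cone_dist_def)
qed

lemma metric_space_cone: "Metric_space K D"
proof
  show "0 \<le> D A B" for A B by (rule cone_dist_nonneg)
  show "D A B = D B A" for A B by (rule cone_dist_commute)
  show "D A B = 0 \<longleftrightarrow> A = B" if A: "A \<in> K" and B: "B \<in> K" for A B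
  proof -
    obtain x s where x: "x \<in> M" "s \<in> {0..1}" "A = point x s" using cone_cases[OF A] .
    obtain y t where y: "y \<in> M" "t \<in> {0..1}" "B = point y t" using cone_cases[OF B] .
    have "D A B = 0 \<longleftrightarrow> s = t \<and> (s = 0 \<or> x = y)"
      using x y ang_range[of x y] by (simp add: dist_point polar_dist_eq_0 ang_eq_0)
    moreover have "A = B" if "s = t \<and> (s = 0 \<or> x = y)"
      using that x y point_zero by auto
    moreover have "D A A = 0"
      using x ang_range[of x x] by (simp add: dist_point polar_dist_eq_0 ang_eq_0)
    ultimately show ?thesis by auto
  qed
  show "D A C \<le> D A B + D B C" if A: "A \<in> K" and B: "B \<in> K" and C: "C \<in> K" for A B C
  proof -
    obtain x s where x: "x \<in> M" "s \<in> {0..1}" "A = point x s" using cone_cases[OF A] .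
    obtain y t where y: "y \<in> M" "t \<in> {0..1}" "B = point y t" using cone_cases[OF B] .
    obtain z r where z: "z \<in> M" "r \<in> {0..1}" "C = point z r" using cone_cases[OF C] .
    have "polar_dist s r (ang x z) \<le> polar_dist s t (ang x y) + polar_dist t r (ang y z)"
      using x y z ang_range ang_triangle by (intro polar_dist_triangle) auto
    then show ?thesis using x y z by (simp add: dist_point)
  qed
qed

text \<open>The part of the cone over a geodesic of angle L < pi unrolls isometrically to a plane
  sector of angle L, whose straight segments pull back to geodesics. The factor 2 in
  \<open>F\<close> compensates the 1/2 in the cone metric.\<close>

lemma geodesic_cone_small_angle:
  assumes g: "geodesic M d x y g" and xy: "x \<in> M" "y \<in> M" and st: "s \<in> {0..1}" "t \<in> {0..1}"
    and lt: "ang x y < pi"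
  shows "\<exists>p. geodesic K D (point x s) (point y t) p"
proof -
  define L where "L = ang x y"
  have L: "0 \<le> L" "L < pi" using ang_range lt by (auto simp: L_def)
  have dL: "d x y = L * \<beta> / pi"
    using lt beta_pos by (auto simp: L_def ang_eq_min min_def split: if_splits)
  have par: "\<phi> * \<beta> / pi \<in> {0..d x y}" if "\<phi> \<in> {0..L}" for \<phi>
    using that beta_pos by (auto simp: dL divide_right_mono)
  define F where "F z \<phi> = point (g (\<phi> * \<beta> / pi)) (2 * cmod z)" for z \<phi>
  have gM: "g (\<phi> * \<beta> / pi) \<in> M" if "\<phi> \<in> {0..L}" for \<phi>
    using geodesic_dist[OF g par[OF that]] by simp
  have angg: "ang (g (\<phi> * \<beta> / pi)) (g (\<psi> * \<beta> / pi)) = \<bar>\<phi> - \<psi>\<bar>" if "\<phi> \<in> {0..L}" "\<psi> \<in> {0..L}" for \<phi> \<psi>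
  proof -
    have "d (g (\<phi> * \<beta> / pi)) (g (\<psi> * \<beta> / pi)) = \<bar>\<phi> * \<beta> / pi - \<psi> * \<beta> / pi\<bar>"
      using g par[OF that(1)] par[OF that(2)] unfolding geodesic_def by blast
    also have "\<phi> * \<beta> / pi - \<psi> * \<beta> / pi = (\<phi> - \<psi>) * (\<beta> / pi)" by (simp add: field_simps)
    also have "\<bar>(\<phi> - \<psi>) * (\<beta> / pi)\<bar> = \<bar>\<phi> - \<psi>\<bar> * (\<beta> / pi)" using beta_pos by (simp add: abs_mult)
    finally show ?thesis unfolding ang_eq_min using beta_pos that L by (auto simp: min_def)
  qed
  have DF: "D (F z \<phi>) (F w \<psi>) = dist z w"
    if "\<phi> \<in> {0..L}" "\<psi> \<in> {0..L}" "2 * cmod z \<le> 1" "2 * cmod w \<le> 1"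
      "z = rcis (cmod z) \<phi>" "w = rcis (cmod w) \<psi>" for z w \<phi> \<psi>
  proof -
    have "D (F z \<phi>) (F w \<psi>) = polar_dist (2 * cmod z) (2 * cmod w) \<bar>\<phi> - \<psi>\<bar> / 2"
      using that by (simp add: F_def dist_point gM angg)
    also have "\<dots> = polar_dist (2 * cmod z) (2 * cmod w) (\<phi> - \<psi>) / 2"
      by (simp add: polar_dist_def)
    also have "\<dots> = polar_dist (cmod z) (cmod w) (\<phi> - \<psi>)"
    proof -
      have "(2 * cmod z)\<^sup>2 + (2 * cmod w)\<^sup>2 - 2 * (2 * cmod z) * (2 * cmod w) * cos (\<phi> - \<psi>) =
        2\<^sup>2 * ((cmod z)\<^sup>2 + (cmod w)\<^sup>2 - 2 * cmod z * cmod w * cos (\<phi> - \<psi>))"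
        by (simp add: power2_eq_square algebra_simps)
      then show ?thesis unfolding polar_dist_def by (simp only: real_sqrt_mult) simp
    qed
    also have "\<dots> = dist z w" by (metis dist_rcis that(5,6))
    finally show ?thesis .
  qed
  have FK: "F z \<phi> \<in> K" if "\<phi> \<in> {0..L}" "2 * cmod z \<le> 1" for z \<phi>
    unfolding F_def using that gM by (intro point_in_cone) auto
  define v w where "v = rcis (s / 2) 0" and "w = rcis (t / 2) L"
  have nvw: "cmod v = s / 2" "cmod w = t / 2" using st by (simp_all add: v_def w_def)
  have seg: "\<exists>\<phi>\<in>{0..L}. z = rcis (cmod z) \<phi>" if "z \<in> closed_segment v w" for z
    using sector_polar[OF L, of "s / 2" "t / 2" z] that st by (simp add: v_def w_def)
  have small: "2 * cmod z \<le> 1" if "z \<in> closed_segment v w" for z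
  proof -
    have "v \<in> cball 0 (1/2)" "w \<in> cball 0 (1/2)" using nvw st by auto
    then have "closed_segment v w \<subseteq> cball 0 (1/2)" by (intro closed_segment_subset) auto
    then show ?thesis using that by auto
  qed
  obtain \<Phi> where \<Phi>: "\<And>z. z \<in> closed_segment v w \<Longrightarrow> \<Phi> z \<in> {0..L} \<and> z = rcis (cmod z) (\<Phi> z)"
    using seg by metis
  \<comment> \<open>At the origin \<open>\<Phi>\<close> may return any angle of the sector; distance
    0 shows that the endpoints are nevertheless the intended points.\<close>
  have "D (F v (\<Phi> v)) (F v 0) = dist v v" "D (F w (\<Phi> w)) (F w L) = dist w w"
    using \<Phi>[of v] \<Phi>[of w] small[of v] small[of w] L nvw
    by (intro DF; auto simp: v_def w_def)+
  then have "F v (\<Phi> v) = F v 0" "F w (\<Phi> w) = F w L"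
    using Metric_space.zero[OF metric_space_cone] FK \<Phi>[of v] \<Phi>[of w] small[of v] small[of w] L
    by (simp_all)
  moreover have "F v 0 = point x s" "F w L = point y t"
    using g beta_pos by (simp_all add: F_def nvw geodesic_def flip: dL)
  ultimately have "geodesic K D (point x s) (point y t)
      (\<lambda>a. F (v + (a / dist v w) *\<^sub>R (w - v)) (\<Phi> (v + (a / dist v w) *\<^sub>R (w - v))))"
    using geodesic_of_segment[of v w "\<lambda>z. F z (\<Phi> z)" K D] FK DF \<Phi> small by simp
  then show ?thesis by blast
qed

text \<open>At angle pi the distance is (s + t)/2, the length of the path through the apex. Two
  opposite rays are unrolled to the real line, with the apex at 0.\<close>

lemma geodesic_cone_apex:
  assumes xy: "x \<in> M" "y \<in> M" and st: "s \<in> {0..1}" "t \<in> {0..1}" and eq: "ang x y = pi"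
  shows "\<exists>p. geodesic K D (point x s) (point y t) p"
proof -
  define f where "f a = (if 0 \<le> a then point x (2 * a) else point y (- 2 * a))" for a
  have seg: "- t / 2 \<le> a \<and> a \<le> s / 2" if "a \<in> closed_segment (s / 2) (- t / 2)" for a
    using that st by (auto simp: closed_segment_eq_real_ivl split: if_splits)
  have same: "polar_dist a b 0 = \<bar>a - b\<bar>" and opp: "polar_dist a b pi = \<bar>a + b\<bar>" for a b
    unfolding polar_dist_def real_sqrt_abs[symmetric] by (simp_all add: power2_eq_square algebra_simps)
  have z: "ang x x = 0" "ang y y = 0" "ang y x = pi" using xy eq by (auto simp: ang_eq_0 ang_commute[of y x])
  have "geodesic K D (f (s / 2)) (f (- t / 2))
      (\<lambda>a. f (s / 2 + (a / dist (s / 2) (- t / 2)) *\<^sub>R (- t / 2 - s / 2)))"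
  proof (rule geodesic_of_segment)
    fix a assume a: "a \<in> closed_segment (s / 2) (- t / 2)"
    show "f a \<in> K" using seg[OF a] st xy by (auto simp: f_def intro!: point_in_cone)
    fix b assume b: "b \<in> closed_segment (s / 2) (- t / 2)"
    show "D (f a) (f b) = dist a b"
      using seg[OF a] seg[OF b] st xy eq z
      by (auto simp: f_def dist_point same opp dist_real_def abs_if)
  qed
  moreover have "f (s / 2) = point x s" "f (- t / 2) = point y t"
    using st xy by (auto simp: f_def point_zero[of y x])
  ultimately show ?thesis by auto
qed

lemma geodesic_space_cone:
  assumes "geodesic_space M d"
  shows "geodesic_space K D"
  unfolding geodesic_space_def
proof (intro conjI ballI metric_space_cone)
  fix A B assume A: "A \<in> K" and B: "B \<in> K"
  obtain x s where x: "x \<in> M" "s \<in> {0..1}" "A = point x s" using cone_cases[OF A] .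
  obtain y t where y: "y \<in> M" "t \<in> {0..1}" "B = point y t" using cone_cases[OF B] .
  obtain g where "geodesic M d x y g" using assms x y by (meson geodesic_space_def)
  then show "\<exists>p. geodesic K D A B p"
    using geodesic_cone_small_angle[of x y g s t] geodesic_cone_apex[of x y s t] x y ang_range[of x y]
    by (cases "ang x y = pi") auto
qed

section \<open>Curvature of the cone\<close>

text \<open>Below perimeter 2 pi no angle is truncated and the inequality for \<open>M\<close>
  applies. Beyond it the truncated angles fall under
  \<open>trig_ineq_large_perimeter\<close>.\<close>

lemma ang_trig_ineq:
  assumes tr: "trig_ineq (pi / \<beta>) M d" and M: "a \<in> M" "b \<in> M" "c \<in> M" "z \<in> M"
    and l: "0 < ang b c" "ang b c < pi" "ang b z + ang z c = ang b c"
  shows "sin (ang z c) * cos (ang b a) + sin (ang b z) * cos (ang c a) \<le> sin (ang b c) * cos (ang z a)"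
proof -
  let ?\<rho> = "pi / \<beta>"
  have rho: "0 < ?\<rho>" using beta_pos by simp
  have lt: "ang b z < pi" "ang z c < pi" using l ang_range[of b z] ang_range[of z c] by linarith+
  have e: "ang b c = ?\<rho> * d b c" "ang b z = ?\<rho> * d b z" "ang z c = ?\<rho> * d z c"
    using l(2) lt by (simp_all add: ang_eq_min min_def split: if_splits)
  have "?\<rho> * (d b z + d z c) = ?\<rho> * d b c" using l e by (simp add: distrib_left)
  then have btw: "d b z + d z c = d b c" using beta_pos by simp
  show ?thesis
  proof (cases "?\<rho> * (d a b + d b c + d c a) < 2 * pi")
    case True
    note * = mult_less_pi_of_half[OF True rho]
    have "2 * d b a \<le> d a b + d b c + d c a" "2 * d c a \<le> d a b + d b c + d c a"
        "2 * d z a \<le> d a b + d b c + d c a"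
      using triangle[OF M(1,3,2)] triangle[OF M(3,2,1)] triangle[OF M(4,2,1)] triangle[OF M(4,3,1)] btw
        commute[of a b] commute[of b c] commute[of c a] commute[of z b] by - linarith+
    from this[THEN *] have "ang b a = ?\<rho> * d a b" "ang c a = ?\<rho> * d c a" "ang z a = ?\<rho> * d z a"
      using commute[of b a] by (simp_all add: ang_eq_min)
    then show ?thesis
      using tr[unfolded trig_ineq_def, rule_format, OF M btw True] by (simp add: e)
  next
    case False
    \<comment> \<open>Truncation cannot push the sum below 2 pi: if one side is cut to pi, the other
      two add up to at least pi.\<close>
    have "2 * pi \<le> ang b a + ang c a + ang b c"
    proof -
      have "ang b a = ?\<rho> * d a b \<or> ang b a = pi" "ang c a = ?\<rho> * d c a \<or> ang c a = pi"
        by (auto simp: ang_eq_min min_def commute[of b a])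
      moreover have "2 * pi \<le> ?\<rho> * d a b + ang b c + ?\<rho> * d c a" using False by (simp add: e distrib_left)
      ultimately show ?thesis
        using ang_triangle[OF M(2,3,1)] ang_triangle[OF M(3,2,1)] ang_commute[of c b] by linarith
    qed
    then show ?thesis
      using l ang_range ang_triangle[OF M(4,2,1)] ang_triangle[OF M(4,3,1)] ang_commute[of z b]
      by (intro trig_ineq_large_perimeter) (auto simp: algebra_simps)
  qed
qed

lemma flat_ineq_cone:
  assumes tr: "trig_ineq (pi / \<beta>) M d"
  shows "flat_ineq K D"
  unfolding flat_ineq_def
proof (intro ballI impI)
  fix A B C Z assume K: "A \<in> K" "B \<in> K" "C \<in> K" "Z \<in> K" and btw: "D B Z + D Z C = D B C"
  obtain a u where a: "a \<in> M" "u \<in> {0..1}" "A = point a u" using cone_cases[OF K(1)] .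
  obtain b s where b: "b \<in> M" "s \<in> {0..1}" "B = point b s" using cone_cases[OF K(2)] .
  obtain c t where c: "c \<in> M" "t \<in> {0..1}" "C = point c t" using cone_cases[OF K(3)] .
  obtain z r where z: "z \<in> M" "r \<in> {0..1}" "Z = point z r" using cone_cases[OF K(4)] .
  note sq = dist_point_square
  show "D B C * (D Z A)\<^sup>2 \<le> D Z C * (D A B)\<^sup>2 + D B Z * (D C A)\<^sup>2 - D B Z * D Z C * D B C"
  proof (cases "D B C = 0")
    case True
    then have "D B Z = 0" "D Z C = 0"
      using btw cone_dist_nonneg[of B Z] cone_dist_nonneg[of Z C] by linarith+
    then show ?thesis using True by simp
  next
    case False
    define p q E where "p = D B Z" and "q = D Z C" and "E = D B C"
    have E: "0 < E" "p + q = E" "0 \<le> p" "0 \<le> q"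
      using False btw cone_dist_nonneg by (auto simp: E_def p_def q_def less_le)
    \<comment> \<open>The radii of B and C multiplied by the barycentric weights of Z on the
      segment.\<close>
    define S T where "S = q / E * s" and "T = p / E * t"
    have ES: "E * S = q * s" "E * T = p * t" using E by (simp_all add: S_def T_def)
    have p2: "4 * p\<^sup>2 = s\<^sup>2 + r\<^sup>2 - 2 * s * r * cos (ang b z)"
      and q2: "4 * q\<^sup>2 = r\<^sup>2 + t\<^sup>2 - 2 * r * t * cos (ang z c)"
      and E2: "4 * E\<^sup>2 = s\<^sup>2 + t\<^sup>2 - 2 * s * t * cos (ang b c)"
      unfolding p_def q_def E_def a b c z using b c z by (simp_all add: sq)
    have quad: "E\<^sup>2 * (S\<^sup>2 + T\<^sup>2 + 2 * S * T * cos (ang b c)) = E * (q * s\<^sup>2 + p * t\<^sup>2 - 4 * (p * q * E))"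
    proof -
      have "E\<^sup>2 * (S\<^sup>2 + T\<^sup>2 + 2 * S * T * cos (ang b c)) =
          (E * S)\<^sup>2 + (E * T)\<^sup>2 + 2 * (E * S) * (E * T) * cos (ang b c)"
        by (simp add: power2_eq_square algebra_simps)
      also have "\<dots> = q\<^sup>2 * s\<^sup>2 + p\<^sup>2 * t\<^sup>2 + p * q * (2 * s * t * cos (ang b c))"
        unfolding ES by (simp add: power2_eq_square algebra_simps)
      also have "2 * s * t * cos (ang b c) = s\<^sup>2 + t\<^sup>2 - 4 * E\<^sup>2" using E2 by simp
      also have "q\<^sup>2 * s\<^sup>2 + p\<^sup>2 * t\<^sup>2 + p * q * (s\<^sup>2 + t\<^sup>2 - 4 * E\<^sup>2) = E * (q * s\<^sup>2 + p * t\<^sup>2 - 4 * (p * q * E))"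
        unfolding E(2)[symmetric] by (simp add: power2_eq_square algebra_simps)
      finally show ?thesis .
    qed
    \<comment> \<open>Formally the squared distance from Z to the dividing point of B and C.
      Weighting the laws of cosines for p and q by q and p gives 0 because p + q = E.\<close>
    have "E\<^sup>2 * (r\<^sup>2 - 2 * r * (S * cos (ang b z) + T * cos (ang z c)) +
        (S\<^sup>2 + T\<^sup>2 + 2 * S * T * cos (ang b c)))
       = E * (E * r\<^sup>2) - 2 * r * E * ((E * S) * cos (ang b z) + (E * T) * cos (ang z c)) +
        E\<^sup>2 * (S\<^sup>2 + T\<^sup>2 + 2 * S * T * cos (ang b c))"
      by (simp add: power2_eq_square algebra_simps)
    also have "\<dots> = E * (q * (s\<^sup>2 + r\<^sup>2 - 2 * s * r * cos (ang b z)) +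
        p * (r\<^sup>2 + t\<^sup>2 - 2 * r * t * cos (ang z c)) - 4 * (p * q * E))"
      unfolding quad ES unfolding E(2)[symmetric] by (simp add: power2_eq_square algebra_simps)
    also have "\<dots> = E * (q * (4 * p\<^sup>2) + p * (4 * q\<^sup>2) - 4 * (p * q * E))" unfolding p2 q2 ..
    also have "\<dots> = 0" unfolding E(2)[symmetric] by (simp add: power2_eq_square algebra_simps)
    finally have eq: "r\<^sup>2 - 2 * r * (S * cos (ang b z) + T * cos (ang z c)) +
        (S\<^sup>2 + T\<^sup>2 + 2 * S * T * cos (ang b c)) = 0" using E by simp
    have "r\<^sup>2 = S\<^sup>2 + T\<^sup>2 + 2 * S * T * cos (ang b c) \<and>
      S * cos (ang b a) + T * cos (ang c a) \<le> r * cos (ang z a)"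
    proof (rule cone_inner_concave[of S T r "ang b c" "ang b z" "ang z c"])
      show "0 \<le> S" "0 \<le> T" "0 \<le> r" using E b c z by (auto simp: S_def T_def)
      show "ang b c \<le> ang b z + ang z c" "ang b c \<le> ang b a + ang c a"
        using ang_triangle[OF b(1) z(1) c(1)] ang_triangle[OF b(1) a(1) c(1)] by (simp_all add: ang_commute[of c a])
      show "ang b z = 0 \<Longrightarrow> ang z a = ang b a" "ang z c = 0 \<Longrightarrow> ang z a = ang c a"
        using b z c by (auto simp: ang_eq_0)
    qed (use eq ang_range ang_trig_ineq[OF tr a(1) b(1) c(1) z(1)] in auto)
    then have rST: "r\<^sup>2 = S\<^sup>2 + T\<^sup>2 + 2 * S * T * cos (ang b c)"
      and conc: "S * cos (ang b a) + T * cos (ang c a) \<le> r * cos (ang z a)" by auto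
    \<comment> \<open>Stewart's theorem with the apex as vertex holds with equality; using it to
      eliminate r^2 leaves only the inner products with A to compare.\<close>
    have r2: "E * r\<^sup>2 = q * s\<^sup>2 + p * t\<^sup>2 - 4 * (p * q * E)"
      using quad E unfolding rST[symmetric] by (simp add: power2_eq_square)
    have "E * (r * cos (ang z a)) \<ge> E * (S * cos (ang b a) + T * cos (ang c a))"
      using conc E by (intro mult_left_mono) auto
    also have "E * (S * cos (ang b a) + T * cos (ang c a)) = (E * S) * cos (ang b a) + (E * T) * cos (ang c a)"
      by (simp add: algebra_simps)
    finally have "q * s * cos (ang b a) + p * t * cos (ang c a) \<le> E * (r * cos (ang z a))"
      unfolding ES .
    then have le: "2 * u * (q * s * cos (ang b a) + p * t * cos (ang c a)) \<le> 2 * u * (E * (r * cos (ang z a)))"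
      using a by (intro mult_left_mono) auto
    have "4 * (E * (D Z A)\<^sup>2) = E * (4 * (D Z A)\<^sup>2)" by simp
    also have "\<dots> = E * r\<^sup>2 + E * u\<^sup>2 - 2 * u * (E * (r * cos (ang z a)))"
      unfolding a(3) z(3) sq[OF z(1) a(1) z(2) a(2)] by (simp add: algebra_simps)
    also have "\<dots> \<le> (q * s\<^sup>2 + p * t\<^sup>2 - 4 * (p * q * E)) + E * u\<^sup>2 -
        2 * u * (q * s * cos (ang b a) + p * t * cos (ang c a))"
      unfolding r2 using le by linarith
    also have "\<dots> = q * (u\<^sup>2 + s\<^sup>2 - 2 * u * s * cos (ang a b)) + p * (t\<^sup>2 + u\<^sup>2 - 2 * t * u * cos (ang c a))
        - 4 * (p * q * E)"
      unfolding ang_commute[of a b] E(2)[symmetric] by (simp add: algebra_simps)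
    also have "\<dots> = q * (4 * (D A B)\<^sup>2) + p * (4 * (D C A)\<^sup>2) - 4 * (p * q * E)"
      unfolding a b c using sq a b c by simp
    finally show ?thesis unfolding p_def[symmetric] q_def[symmetric] E_def[symmetric] by (simp add: algebra_simps)
  qed
qed

text \<open>The vertices are lifted to radius 1 and z to the point of the chord over it. The flat
  inequality for this configuration loses its constant terms and becomes the trigonometric
  one.\<close>

lemma trig_ineq_of_cone:
  assumes fl: "flat_ineq K D"
  shows "trig_ineq (pi / \<beta>) M d"
  unfolding trig_ineq_def
proof (intro ballI impI)
  let ?\<rho> = "pi / \<beta>"
  fix a b c z
  assume M: "a \<in> M" "b \<in> M" "c \<in> M" "z \<in> M" and btw: "d b z + d z c = d b c"
    and per: "?\<rho> * (d a b + d b c + d c a) < 2 * pi"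
  have rho: "0 < ?\<rho>" using beta_pos by simp
  show "sin (?\<rho> * d z c) * cos (?\<rho> * d a b) + sin (?\<rho> * d b z) * cos (?\<rho> * d c a)
      \<le> sin (?\<rho> * d b c) * cos (?\<rho> * d z a)"
  proof (cases "d b c = 0")
    case True
    then have "d b z = 0" "d z c = 0" using btw nonneg[of b z] nonneg[of z c] by linarith+
    then show ?thesis using True by simp
  next
    case False
    note * = mult_less_pi_of_half[OF per rho]
    have "2 * d a b \<le> d a b + d b c + d c a" "2 * d c a \<le> d a b + d b c + d c a"
        "2 * d z a \<le> d a b + d b c + d c a" "2 * d b c \<le> d a b + d b c + d c a"
        "2 * d b z \<le> d a b + d b c + d c a" "2 * d z c \<le> d a b + d b c + d c a"
      using triangle[OF M(1,3,2)] triangle[OF M(3,2,1)] triangle[OF M(4,2,1)] triangle[OF M(4,3,1)]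
        triangle[OF M(2,1,3)] btw nonneg[of b z] nonneg[of z c]
        commute[of a b] commute[of b c] commute[of c a] commute[of z b] by - linarith+
    note lt = this[THEN *]
    then have e: "?\<rho> * d a b = ang b a" "?\<rho> * d c a = ang c a" "?\<rho> * d z a = ang z a"
      "?\<rho> * d b c = ang b c" "?\<rho> * d b z = ang b z" "?\<rho> * d z c = ang z c"
      using commute[of b a] by (simp_all add: ang_eq_min)
    define l \<alpha> \<gamma> where "l = ang b c" and "\<alpha> = ang b z" and "\<gamma> = ang z c"
    have "?\<rho> * d b z + ?\<rho> * d z c = ?\<rho> * d b c" by (simp add: distrib_left flip: btw)
    then have l: "\<alpha> + \<gamma> = l" unfolding e l_def \<alpha>_def \<gamma>_def .
    have "0 < d b c" using False nonneg[of b c] by linarith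
    then have "0 < ?\<rho> * d b c" using rho by (intro mult_pos_pos)
    then have l0: "0 < l" "l < pi" using lt unfolding e l_def by auto
    have ag: "0 \<le> \<alpha>" "0 \<le> \<gamma>" using ang_range by (auto simp: \<alpha>_def \<gamma>_def)
    have sn: "0 \<le> sin \<alpha>" "0 \<le> sin \<gamma>" "0 < sin l"
      using l l0 ag by (auto intro!: sin_ge_zero sin_gt_zero)
    have sl: "sin l = sin \<alpha> * cos \<gamma> + cos \<alpha> * sin \<gamma>" and cl: "cos l = cos \<alpha> * cos \<gamma> - sin \<alpha> * sin \<gamma>"
      using sin_add[of \<alpha> \<gamma>] cos_add[of \<alpha> \<gamma>] l by auto
    define N where "N = sin \<alpha> + sin \<gamma>"
    have slN: "sin l \<le> N"
      unfolding sl N_def using sn mult_left_mono[of "cos \<gamma>" 1 "sin \<alpha>"] mult_right_mono[of "cos \<alpha>" 1 "sin \<gamma>"]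
      by (intro add_mono) auto
    then have N: "0 < N" using sn by linarith
    \<comment> \<open>In the unrolled sector the ray at angles \<alpha>, \<gamma> from two unit
      vectors cuts their triangle into pieces of area r sin \<alpha> / 2 and r sin \<gamma> / 2; the
      whole has area sin l / 2. The same areas show that the chord is divided in the ratio sin
      \<alpha> : sin \<gamma>.\<close>
    define r where "r = sin l / N"
    have r: "r \<in> {0..1}" using sn slN N by (auto simp: r_def)
    define F where "F = polar_dist 1 1 l / 2"
    have F2: "4 * F\<^sup>2 = 2 - 2 * cos l" by (simp add: F_def power_divide polar_dist_square)
    have "F \<noteq> 0" using l0 by (simp add: F_def polar_dist_eq_0)
    then have F0: "0 < F" using polar_dist_nonneg[of 1 1 l] by (auto simp: F_def less_le)
    have side: "polar_dist 1 r \<phi> / 2 = sin \<phi> / N * F"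
      if "N = sin \<phi> + sin \<psi>" "sin l = sin \<phi> * cos \<psi> + cos \<phi> * sin \<psi>"
        "cos l = cos \<phi> * cos \<psi> - sin \<phi> * sin \<psi>" "0 \<le> sin \<phi>" for \<phi> \<psi>
    proof (rule power2_eq_imp_eq)
      have rN: "N * r = sin l" using N by (simp add: r_def)
      have "N\<^sup>2 * (1\<^sup>2 + r\<^sup>2 - 2 * 1 * r * cos \<phi>) = N\<^sup>2 + (N * r)\<^sup>2 - 2 * N * (N * r) * cos \<phi>"
        by (simp add: power2_eq_square algebra_simps)
      also have "\<dots> = (sin \<phi>)\<^sup>2 * (2 - 2 * cos l)"
        unfolding rN unfolding that(1-3) using sin_cos_squared_add[of \<phi>] sin_cos_squared_add[of \<psi>] by algebra
      also have "\<dots> = (sin \<phi>)\<^sup>2 * (4 * F\<^sup>2)" unfolding F2 ..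
      finally have "1\<^sup>2 + r\<^sup>2 - 2 * 1 * r * cos \<phi> = 4 * (sin \<phi> / N * F)\<^sup>2"
        using N by (simp add: field_simps power_mult_distrib power_divide)
      then show "(polar_dist 1 r \<phi> / 2)\<^sup>2 = (sin \<phi> / N * F)\<^sup>2"
        by (simp add: power_divide polar_dist_square)
      show "0 \<le> polar_dist 1 r \<phi> / 2" "0 \<le> sin \<phi> / N * F"
        using polar_dist_nonneg[of 1 r \<phi>] that N F0 by auto
    qed
    have "D (point b 1) (point z r) = polar_dist 1 r \<alpha> / 2" "D (point c 1) (point z r) = polar_dist 1 r \<gamma> / 2"
      using M r by (simp_all add: dist_point \<alpha>_def \<gamma>_def ang_commute[of c z])
    moreover have "polar_dist 1 r \<alpha> / 2 = sin \<alpha> / N * F"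
      by (rule side[OF N_def sl cl sn(1)])
    moreover have "polar_dist 1 r \<gamma> / 2 = sin \<gamma> / N * F"
      by (rule side[of \<gamma> \<alpha>]) (simp_all add: N_def sl cl sn)
    ultimately have DBZ: "D (point b 1) (point z r) = sin \<alpha> / N * F"
      and DZC: "D (point z r) (point c 1) = sin \<gamma> / N * F"
      using cone_dist_commute[of "point z r" "point c 1"] by simp_all
    have DBC: "D (point b 1) (point c 1) = F"
      using M by (simp add: dist_point F_def flip: l_def)
    have sq: "4 * (D (point z r) (point a 1))\<^sup>2 = r\<^sup>2 + 1 - 2 * r * cos (ang z a)"
      "4 * (D (point a 1) (point b 1))\<^sup>2 = 2 - 2 * cos (ang b a)"
      "4 * (D (point c 1) (point a 1))\<^sup>2 = 2 - 2 * cos (ang c a)"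
      using dist_point_square[of z a r 1] dist_point_square[of a b 1 1] dist_point_square[of c a 1 1]
        M r ang_commute[of a b] by auto
    have "sin \<alpha> / N * F + sin \<gamma> / N * F = F"
      using N by (simp add: N_def flip: distrib_right add_divide_distrib)
    then have "D (point b 1) (point z r) + D (point z r) (point c 1) = D (point b 1) (point c 1)"
      unfolding DBZ DZC DBC .
    moreover have "point a 1 \<in> K" "point b 1 \<in> K" "point c 1 \<in> K" "point z r \<in> K"
      using M r by (auto intro!: point_in_cone)
    ultimately have "F * (D (point z r) (point a 1))\<^sup>2 \<le> sin \<gamma> / N * F * (D (point a 1) (point b 1))\<^sup>2 +
        sin \<alpha> / N * F * (D (point c 1) (point a 1))\<^sup>2 - sin \<alpha> / N * F * (sin \<gamma> / N * F) * F"
      using fl unfolding flat_ineq_def by (metis DBZ DZC DBC)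
    also have "\<dots> = F * (sin \<gamma> / N * (D (point a 1) (point b 1))\<^sup>2 +
        sin \<alpha> / N * (D (point c 1) (point a 1))\<^sup>2 - sin \<alpha> / N * (sin \<gamma> / N) * F\<^sup>2)"
      by (simp add: algebra_simps power2_eq_square)
    finally have "(D (point z r) (point a 1))\<^sup>2 \<le> sin \<gamma> / N * (D (point a 1) (point b 1))\<^sup>2 +
        sin \<alpha> / N * (D (point c 1) (point a 1))\<^sup>2 - sin \<alpha> / N * (sin \<gamma> / N) * F\<^sup>2"
      using F0 by (simp only: mult_le_cancel_left_pos)
    then have "4 * (D (point z r) (point a 1))\<^sup>2 \<le> 4 * (sin \<gamma> / N * (D (point a 1) (point b 1))\<^sup>2 +
        sin \<alpha> / N * (D (point c 1) (point a 1))\<^sup>2 - sin \<alpha> / N * (sin \<gamma> / N) * F\<^sup>2)"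
      by (intro mult_left_mono) auto
    also have "\<dots> = sin \<gamma> / N * (4 * (D (point a 1) (point b 1))\<^sup>2) +
        sin \<alpha> / N * (4 * (D (point c 1) (point a 1))\<^sup>2) - sin \<alpha> / N * (sin \<gamma> / N) * (4 * F\<^sup>2)"
      by (simp add: algebra_simps)
    finally have "4 * (D (point z r) (point a 1))\<^sup>2 \<le> sin \<gamma> / N * (4 * (D (point a 1) (point b 1))\<^sup>2) +
        sin \<alpha> / N * (4 * (D (point c 1) (point a 1))\<^sup>2) - sin \<alpha> / N * (sin \<gamma> / N) * (4 * F\<^sup>2)" .
    then have "r\<^sup>2 + 1 - 2 * r * cos (ang z a) \<le> sin \<gamma> / N * (2 - 2 * cos (ang b a)) +
        sin \<alpha> / N * (2 - 2 * cos (ang c a)) - sin \<alpha> / N * (sin \<gamma> / N) * (2 - 2 * cos l)"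
      unfolding F2 sq .
    then have "N\<^sup>2 * (r\<^sup>2 + 1 - 2 * r * cos (ang z a)) \<le> N\<^sup>2 * (sin \<gamma> / N * (2 - 2 * cos (ang b a)) +
        sin \<alpha> / N * (2 - 2 * cos (ang c a)) - sin \<alpha> / N * (sin \<gamma> / N) * (2 - 2 * cos l))"
      by (intro mult_left_mono) auto
    also have "\<dots> = N * (sin \<gamma> * (2 - 2 * cos (ang b a)) + sin \<alpha> * (2 - 2 * cos (ang c a)))
        - sin \<alpha> * sin \<gamma> * (2 - 2 * cos l)"
      using N by (simp add: power2_eq_square field_simps)
    also have "N\<^sup>2 * (r\<^sup>2 + 1 - 2 * r * cos (ang z a)) = (sin l)\<^sup>2 + N\<^sup>2 - 2 * N * sin l * cos (ang z a)"
      using N by (simp add: r_def power2_eq_square field_simps)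
    finally have "(sin l)\<^sup>2 + N\<^sup>2 + sin \<alpha> * sin \<gamma> * (2 - 2 * cos l) - 2 * N * sin l * cos (ang z a)
      \<le> N * (sin \<gamma> * (2 - 2 * cos (ang b a)) + sin \<alpha> * (2 - 2 * cos (ang c a)))" by linarith
    \<comment> \<open>Stewart's theorem with the apex as vertex, multiplied by
      \<open>N\<^sup>2\<close>; it cancels the constant terms.\<close>
    moreover have "(sin l)\<^sup>2 + sin \<alpha> * sin \<gamma> * (2 - 2 * cos l) = N\<^sup>2"
      unfolding sl cl N_def using sin_cos_squared_add[of \<alpha>] sin_cos_squared_add[of \<gamma>] by algebra
    moreover have "N * (sin \<gamma> * (2 - 2 * cos (ang b a)) + sin \<alpha> * (2 - 2 * cos (ang c a))) =
        2 * N\<^sup>2 - 2 * N * (sin \<gamma> * cos (ang b a) + sin \<alpha> * cos (ang c a))"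
      unfolding N_def by (simp add: power2_eq_square algebra_simps)
    ultimately have "N * (sin \<gamma> * cos (ang b a) + sin \<alpha> * cos (ang c a)) \<le> N * (sin l * cos (ang z a))"
      by (simp add: algebra_simps)
    then show ?thesis unfolding e using N by (simp add: l_def \<alpha>_def \<gamma>_def)
  qed
qed

end

section \<open>The equivalence for cones and the three claims\<close>

lemma CAT_0_cone_iff:
  assumes "geodesic_space M d" "0 < \<beta>"
  shows "CAT 0 (metric_cone M) (cone_dist \<beta> d) \<longleftrightarrow> angle_ineq (pi / \<beta>) M d"
proof -
  interpret metric_cone_space M d \<beta>
    using assms by (simp add: metric_cone_space_def metric_cone_space_axioms_def geodesic_space_def)
  show ?thesis
    using flat_ineq_cone trig_ineq_of_cone geodesic_space_cone[OF assms(1)] flat_ineq_imp_CAT_0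
      CAT_0_imp_flat_ineq angle_ineq_iff_trig_ineq[OF Metric_space_axioms, of "pi / \<beta>"] beta_pos
    by auto
qed

theorem theorem4p1:
  fixes X :: "'a set" and d :: "'a \<Rightarrow> 'a \<Rightarrow> real"
  assumes "geodesic_space X d"
  shows "(CAT 0 X d \<longrightarrow> (\<forall>\<beta>>0. CAT 0 (metric_cone X) (cone_dist \<beta> d))) \<and>
    (\<forall>\<beta>\<^sub>1 \<beta>\<^sub>2. 0 < \<beta>\<^sub>1 \<and> \<beta>\<^sub>1 < \<beta>\<^sub>2 \<and> CAT 0 (metric_cone X) (cone_dist \<beta>\<^sub>2 d) \<longrightarrow>
       CAT 0 (metric_cone X) (cone_dist \<beta>\<^sub>1 d)) \<and>
    (\<forall>k\<ge>0. CAT k X d \<longrightarrow>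
       (\<forall>\<beta>>0. (k = 0 \<or> \<beta> \<le> pi / sqrt k) \<longrightarrow> CAT 0 (metric_cone X) (cone_dist \<beta> d)))"
proof -
  have ms: "Metric_space X d" using assms by (simp add: geodesic_space_def)
  note cone = CAT_0_cone_iff[OF assms]
  have three: "CAT 0 (metric_cone X) (cone_dist \<beta> d)"
    if "0 \<le> k" "CAT k X d" "0 < \<beta>" "k = 0 \<or> \<beta> \<le> pi / sqrt k" for k \<beta>
  proof -
    have "angle_ineq (sqrt k) X d"
    proof (cases "k = 0")
      case True
      then show ?thesis using that flat_ineq_imp_angle_ineq CAT_0_imp_flat_ineq by auto
    next
      case False
      then show ?thesis
        using that CAT_imp_trig_ineq[of k X d] angle_ineq_iff_trig_ineq[OF ms, of "sqrt k"] by auto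
    qed
    \<comment> \<open>The bound on \<beta> is exactly the comparison of the two curvature
      parameters; for k = 0 it holds for every positive \<beta>.\<close>
    moreover have "sqrt k \<le> pi / \<beta>" using that by (cases "k = 0") (auto simp: field_simps)
    ultimately show ?thesis
      using that angle_ineq_mono[OF ms, of "sqrt k" "pi / \<beta>"] by (simp add: cone)
  qed
  have two: "CAT 0 (metric_cone X) (cone_dist \<beta>\<^sub>1 d)"
    if "0 < \<beta>\<^sub>1" "\<beta>\<^sub>1 < \<beta>\<^sub>2" "CAT 0 (metric_cone X) (cone_dist \<beta>\<^sub>2 d)" for \<beta>\<^sub>1 \<beta>\<^sub>2
    using that angle_ineq_mono[OF ms, of "pi / \<beta>\<^sub>2" "pi / \<beta>\<^sub>1"] by (simp add: cone frac_le)
  \<comment> \<open>The first claim is the case k = 0 of the third.\<close>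
  show ?thesis using two three three[of 0] by blast
qed

end
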